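(* Let $m>n\ge 2$, $A\in\mathbb{R}^{m\times n}$, $b\in\mathbb{R}^m$ satisfy $0<\sigma_{n+1}<\hat\sigma_n$, and let $x$ be the TLS solution. Then $\underline{\kappa}_1\le\kappa_g(A,b)\le\bar{\kappa}_1$, where $$\underline{\kappa}_1=\frac{\sqrt{1+\|x\|^2}\,\sqrt{\hat\sigma_{n-1}^2+\sigma_{n+1}^2}}{\hat\sigma_{n-1}^2-\sigma_{n+1}^2},\qquad \bar{\kappa}_1=\frac{\sqrt{1+\|x\|^2}\,\sqrt{\hat\sigma_{n}^2+\sigma_{n+1}^2}}{\hat\sigma_{n}^2-\sigma_{n+1}^2}.$$
   Context: $\|\cdot\|$ is the Euclidean norm for vectors and the spectral norm for matrices; $\|\cdot\|_F$ is the Frobenius norm. $\hat\sigma_1\ge\cdots\ge\hat\sigma_n$ are the singular values of $A$ and $\sigma_1\ge\cdots\ge\sigma_{n+1}$ are the singular values of $[A\ \,b]\in\mathbb{R}^{m\times(n+1)}$. The total least squares (TLS) problem is $\min\|[E\ \,r]\|_F$ subject to $b-r\in\mathcal{R}(A+E)$ ($\mathcal R$ = range); under $\sigma_{n+1}<\hat\sigma_n$ its unique solution is $x=(A^TA-\sigma_{n+1}^2I_n)^{-1}A^Tb$. Absolute condition number: for $(\tilde A,\tilde b)$ in a small neighbourhood of $(A,b)$, let $\tilde\sigma_{n+1}$ be the smallest singular value of $[\tilde A\ \,\tilde b]$ and let $g:\mathbb{R}^{m(n+1)}\to\mathbb{R}^n$ be the map $[\mathrm{vec}(\tilde A)^T,\tilde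 b^T]^T\mapsto(\tilde A^T\tilde A-\tilde\sigma_{n+1}^2I_n)^{-1}\tilde A^T\tilde b$, i.e. the TLS solution map, where $\mathrm{vec}$ stacks columns. Then $\kappa_g(A,b):=\|g'([\mathrm{vec}(A)^T,b^T]^T)\|$, the spectral norm of the derivative of $g$ at $(A,b)$. *)

theory Defs
  imports "HOL-Analysis.Analysis"
begin

text \<open>An \<open>m \<times> n\<close> real matrix has type \<open>real^'n^'m\<close>. The library norm on this type is the
  Frobenius norm; spectral norms are operator norms \<open>onorm\<close> with respect to Euclidean norms.\<close>

text \<open>The eigenspace of \<open>M\<^sup>T M\<close> for the eigenvalue \<open>s\<^sup>2\<close>; for \<open>s \<ge> 0\<close> its dimension is the
  multiplicity of \<open>s\<close> as a singular value of \<open>M\<close>.\<close>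

definition right_singular_space :: "real^'c^'r \<Rightarrow> real \<Rightarrow> (real^'c) set" where
  "right_singular_space M s = {v. (transpose M ** M) *v v = s\<^sup>2 *\<^sub>R v}"

text \<open>The square roots of the eigenvalues of \<open>M\<^sup>T M\<close>, with multiplicity, in decreasing order.
  There are as many as \<open>M\<close> has columns, so this is the usual list of singular values when \<open>M\<close> has
  at least as many rows as columns (the only case used); otherwise it is padded by zeros.\<close>

definition singular_values :: "real^'c^'r \<Rightarrow> real list" where
  "singular_values M =
     concat (map (\<lambda>s. replicate (dim (right_singular_space M s)) s)
       (rev (sorted_list_of_set {s. 0 \<le> s \<and> (\<exists>v\<in>right_singular_space M s. v \<noteq> 0)})))"

text \<open>The \<open>k\<close>-th largest singular value, counted from \<open>k = 1\<close>.\<close>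

definition singular_value :: "real^'c^'r \<Rightarrow> nat \<Rightarrow> real" where
  "singular_value M k = singular_values M ! (k - 1)"

text \<open>The matrix \<open>[A b]\<close>; the index \<open>None\<close> is that of the appended column.\<close>

definition append_col :: "real^'n^'m \<Rightarrow> real^'m \<Rightarrow> real^('n option)^'m" where
  "append_col A b = (\<chi> i k. case k of Some j \<Rightarrow> A $ i $ j | None \<Rightarrow> b $ i)"

text \<open>The total least squares problem is to minimise \<open>\<parallel>[E r]\<parallel>\<^sub>F\<close> over the feasible \<open>(E, r)\<close>; a
  solution is an \<open>x\<close> solving the corrected system for a minimising \<open>(E, r)\<close>.\<close>

definition tls_feasible :: "real^'n^'m \<Rightarrow> real^'m \<Rightarrow> real^'n^'m \<Rightarrow> real^'m \<Rightarrow> bool" where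
  "tls_feasible A b E r \<longleftrightarrow> b - r \<in> range ((*v) (A + E))"

definition tls_solution :: "real^'n^'m \<Rightarrow> real^'m \<Rightarrow> real^'n \<Rightarrow> bool" where
  "tls_solution A b x \<longleftrightarrow>
     (\<exists>E r. (A + E) *v x = b - r \<and>
        (\<forall>E' r'. tls_feasible A b E' r' \<longrightarrow> norm (append_col E r) \<le> norm (append_col E' r')))"

definition tls_formula :: "real^'n^'m \<Rightarrow> real^'m \<Rightarrow> real^'n" where
  "tls_formula A b =
     matrix_inv (transpose A ** A
         - (singular_value (append_col A b) (CARD('n) + 1))\<^sup>2 *\<^sub>R mat 1)
       *v (transpose A *v b)"

text \<open>The data \<open>(A, b)\<close> as a vector \<open>[vec(A)\<^sup>T, b\<^sup>T]\<^sup>T\<close>. The coordinates are indexed by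
  \<open>Inl (j, i)\<close> for the entry of \<open>A\<close> in column \<open>j\<close> and row \<open>i\<close>, and by \<open>Inr i\<close> for \<open>b\<close>.\<close>

definition data_vec :: "real^'n^'m \<Rightarrow> real^'m \<Rightarrow> real^(('n::finite \<times> 'm::finite) + 'm)" where
  "data_vec A b = (\<chi> k. case k of Inl (j, i) \<Rightarrow> A $ i $ j | Inr i \<Rightarrow> b $ i)"

definition data_mat :: "real^(('n::finite \<times> 'm::finite) + 'm) \<Rightarrow> real^'n^'m" where
  "data_mat y = (\<chi> i j. y $ Inl (j, i))"

definition data_rhs :: "real^(('n::finite \<times> 'm::finite) + 'm) \<Rightarrow> real^'m" where
  "data_rhs y = (\<chi> i. y $ Inr i)"

text \<open>The map \<open>g\<close>. It is a total function, but only its values near a point \<open>data_vec A b\<close> with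
  \<open>\<sigma>\<^sub>n\<^sub>+\<^sub>1[A b] < \<sigma>\<^sub>n(A)\<close> matter, and there the inverse exists.\<close>

definition tls_map :: "real^(('n::finite \<times> 'm::finite) + 'm) \<Rightarrow> real^'n" where
  "tls_map y = tls_formula (data_mat y) (data_rhs y)"

text \<open>The absolute condition number. It is meaningful only where \<open>tls_map\<close> is differentiable.\<close>

definition tls_cond :: "real^'n^'m \<Rightarrow> real^'m \<Rightarrow> real" where
  "tls_cond A b = onorm (frechet_derivative tls_map (at (data_vec A b)))"

end

theory Submission
  imports Defs
begin

text \<open>Write \<open>\<lambda> = \<sigma>\<^sub>n\<^sub>+\<^sub>1\<^sup>2\<close>, \<open>P = A\<^sup>T A - \<lambda> I\<close>, \<open>r = b - A x\<close>, \<open>\<rho> = 1 + \<parallel>x\<parallel>\<^sup>2\<close>. The vector \<open>(x, -1)\<close> is an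
  eigenvector of \<open>[A b]\<^sup>T [A b]\<close> for \<open>\<lambda>\<close>, so \<open>A\<^sup>T r = -\<lambda> x\<close> and \<open>\<parallel>r\<parallel>\<^sup>2 = \<lambda> \<rho>\<close>. Subtracting the eigenvector
  equations for two data sets gives exact formulas for the change of \<open>x\<close> and of \<open>\<lambda>\<close>; together with
  continuity of the solution map they yield the derivative \<open>K\<close>, where
  \<open>P (K d) = A\<^sup>T s + \<Delta>A\<^sup>T r + 2 (r \<bullet> s) x / \<rho>\<close> with \<open>s = \<Delta>b - \<Delta>A x\<close>. For the adjoint one finds
  \<open>\<parallel>K\<^sup>T P u\<parallel>\<^sup>2 = \<rho> (\<parallel>A u\<parallel>\<^sup>2 + \<lambda> \<parallel>u\<parallel>\<^sup>2) - 2 \<lambda> (x \<bullet> u)\<^sup>2\<close>. Dropping the last term gives the upper bound. For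
  the lower bound choose \<open>u \<noteq> 0\<close> orthogonal to \<open>x\<close> in the span of the last two right singular vectors
  of \<open>A\<close>.\<close>

subsection \<open>Singular values\<close>

lemma inner_gram: "((transpose M ** M) *v v) \<bullet> w = (M *v v) \<bullet> (M *v w)"
  for M :: "real^'c^'r"
  by (metis dot_lmul_matrix matrix_vector_mul_assoc transpose_matrix_vector)

text \<open>A quadratic that vanishes at 0 and is nonnegative has its minimum there, so its slope is
  0. The test value \<open>t = - a / k\<close> works because \<open>k\<close> exceeds both 0 and
  \<open>c\<close>.\<close>

lemma linear_term_eq_0:
  fixes a c :: real
  assumes "\<And>t. 0 \<le> 2 * t * a + t\<^sup>2 * c"
  shows "a = 0"
proof (rule ccontr)
  assume "a \<noteq> 0"
  define k where "k = \<bar>c\<bar> + 1"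
  have k: "k > 0" "c < k" unfolding k_def by auto
  have "0 \<le> 2 * (- a / k) * a + (- a / k)\<^sup>2 * c" by (rule assms)
  also have "\<dots> = a\<^sup>2 * (c - 2 * k) / k\<^sup>2"
    using k by (simp add: field_simps power2_eq_square)
  also have "\<dots> < 0"
    using k \<open>a \<noteq> 0\<close> by (intro divide_neg_pos mult_pos_neg) auto
  finally show False by simp
qed

text \<open>First variation: \<open>v\<close> minimises
  \<open>(norm (M *v w))^2 - \<mu> * (norm w)^2\<close> over \<open>W\<close>. The residual
  \<open>z\<close> is an admissible direction since \<open>W\<close> is invariant, and the
  derivative in that direction is \<open>2 * (z \<bullet> z)\<close>.\<close>

lemma rayleigh_minimizer_eigenvector:
  fixes M :: "real^'c^'r"
  assumes W: "subspace W" "\<And>w. w \<in> W \<Longrightarrow> (transpose M ** M) *v w \<in> W"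
    and le: "\<And>w. w \<in> W \<Longrightarrow> \<mu> * (norm w)\<^sup>2 \<le> (norm (M *v w))\<^sup>2"
    and v: "v \<in> W" "(norm (M *v v))\<^sup>2 \<le> \<mu> * (norm v)\<^sup>2"
  shows "(transpose M ** M) *v v = \<mu> *\<^sub>R v"
proof -
  define z where "z = (transpose M ** M) *v v - \<mu> *\<^sub>R v"
  have zW: "z \<in> W" unfolding z_def using W v by (simp add: subspace_diff subspace_scale)
  have zz: "z \<bullet> z = (M *v v) \<bullet> (M *v z) - \<mu> * (v \<bullet> z)"
    by (subst (1) z_def) (simp add: inner_diff_left inner_gram)
  have "0 \<le> 2 * t * (z \<bullet> z) + t\<^sup>2 * ((norm (M *v z))\<^sup>2 - \<mu> * (norm z)\<^sup>2)" for t
  proof -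
    have "v + t *\<^sub>R z \<in> W" using W v zW by (simp add: subspace_add subspace_scale)
    from le[OF this] have "\<mu> * (v \<bullet> v + 2 * t * (v \<bullet> z) + t\<^sup>2 * (z \<bullet> z))
        \<le> (M *v v) \<bullet> (M *v v) + 2 * t * ((M *v v) \<bullet> (M *v z)) + t\<^sup>2 * ((M *v z) \<bullet> (M *v z))"
      unfolding power2_norm_eq_inner
      by (simp add: matrix_vector_right_distrib inner_add_left inner_add_right
          matrix_vector_mult_scaleR inner_commute algebra_simps power2_eq_square)
    moreover have "2 * t * (z \<bullet> z) = 2 * t * ((M *v v) \<bullet> (M *v z)) - \<mu> * (2 * t * (v \<bullet> z))"
      by (subst zz) (simp add: algebra_simps)
    ultimately show ?thesis using v(2)
      unfolding power2_norm_eq_inner by (simp add: algebra_simps)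
  qed
  then have "z \<bullet> z = 0" by (rule linear_term_eq_0)
  then show ?thesis by (simp add: z_def)
qed

text \<open>The unit sphere of \<open>W\<close> is compact, so the Rayleigh quotient attains its
  minimum on it; homogeneity extends the bound to \<open>W\<close>.\<close>

lemma least_eigenvalue_exists:
  fixes M :: "real^'c^'r"
  assumes W: "subspace W" "\<And>w. w \<in> W \<Longrightarrow> (transpose M ** M) *v w \<in> W"
    and ne: "w0 \<in> W" "w0 \<noteq> 0"
  obtains \<mu> v where "0 \<le> \<mu>" "v \<in> W" "v \<noteq> 0" "(transpose M ** M) *v v = \<mu> *\<^sub>R v"
    "\<And>w. w \<in> W \<Longrightarrow> \<mu> * (norm w)\<^sup>2 \<le> (norm (M *v w))\<^sup>2"
proof -
  have 1: "compact (sphere 0 1 \<inter> W)"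
    using W(1) by (intro compact_Int_closed compact_sphere closed_subspace)
  have 2: "sphere 0 1 \<inter> W \<noteq> {}"
  proof -
    have "w0 /\<^sub>R norm w0 \<in> sphere 0 1 \<inter> W"
      using ne W(1) by (auto simp: subspace_scale)
    then show ?thesis by blast
  qed
  have 3: "continuous_on (sphere 0 1 \<inter> W) (\<lambda>v. norm (M *v v))"
    by (intro continuous_intros matrix_vector_mult_linear_continuous_on)
  obtain v where v: "v \<in> W" "norm v = 1"
    and min: "\<And>w. w \<in> W \<Longrightarrow> norm w = 1 \<Longrightarrow> norm (M *v v) \<le> norm (M *v w)"
    using continuous_attains_inf[OF 1 2 3] by auto
  define \<mu> where "\<mu> = (norm (M *v v))\<^sup>2"
  have le: "\<mu> * (norm w)\<^sup>2 \<le> (norm (M *v w))\<^sup>2" if "w \<in> W" for w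
  proof (cases "w = 0")
    case False
    have "norm (M *v v) \<le> norm (M *v (w /\<^sub>R norm w))"
      using W(1) that False by (intro min) (auto simp: subspace_scale)
    then have "norm (M *v v) * norm w \<le> norm (M *v w)"
      using False by (simp add: matrix_vector_mult_scaleR field_simps)
    from power_mono[OF this, of 2] show ?thesis
      by (simp add: \<mu>_def power_mult_distrib)
  qed simp
  show thesis
  proof (rule that)
    show "0 \<le> \<mu>" by (simp add: \<mu>_def)
    show "v \<noteq> 0" using v(2) by auto
    show "(transpose M ** M) *v v = \<mu> *\<^sub>R v"
      by (rule rayleigh_minimizer_eigenvector[OF W le]) (auto simp: v \<mu>_def)
  qed (use v le in auto)
qed

section \<open>Decomposition of the space into eigenspaces\<close>

lemma right_singular_space_subspace: "subspace (right_singular_space M s)"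
  unfolding right_singular_space_def
  by (auto simp: subspace_def matrix_vector_right_distrib matrix_vector_mult_scaleR scaleR_add_right)

text \<open>The Gram matrix is symmetric, and distinct nonnegative \<open>s\<close>,
  \<open>t\<close> have distinct squares, which are the eigenvalues.\<close>

lemma right_singular_space_orthogonal:
  assumes "v \<in> right_singular_space M s" "w \<in> right_singular_space M t" "0 \<le> s" "0 \<le> t" "s \<noteq> t"
  shows "v \<bullet> w = 0"
proof -
  have "s\<^sup>2 * (v \<bullet> w) = ((transpose M ** M) *v v) \<bullet> w"
    using assms(1) by (simp add: right_singular_space_def)
  also have "\<dots> = ((transpose M ** M) *v w) \<bullet> v"
    unfolding inner_gram by (rule inner_commute)
  also have "\<dots> = t\<^sup>2 * (v \<bullet> w)"
    using assms(2) by (simp add: right_singular_space_def inner_commute)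
  finally have "(s\<^sup>2 - t\<^sup>2) * (v \<bullet> w) = 0" by (simp add: algebra_simps)
  moreover have "s\<^sup>2 \<noteq> t\<^sup>2" using assms by simp
  ultimately show ?thesis by simp
qed

definition singular_value_set :: "real^'c^'r \<Rightarrow> real set" where
  "singular_value_set M = {s. 0 \<le> s \<and> (\<exists>v\<in>right_singular_space M s. v \<noteq> 0)}"

text \<open>Otherwise the orthogonal complement of the eigenspaces, being invariant, would contain a
  minimiser of the Rayleigh quotient, which is an eigenvector.\<close>

lemma span_right_singular_spaces:
  fixes M :: "real^'c^'r"
  shows "span (\<Union>s\<in>singular_value_set M. right_singular_space M s) = UNIV" (is "span ?S = UNIV")
proof (rule ccontr)
  assume "span ?S \<noteq> UNIV"
  from span_not_UNIV_orthogonal[OF this] obtain a where a: "a \<noteq> 0" "\<forall>x\<in>span ?S. a \<bullet> x = 0"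
    by blast
  define W where "W = {w. \<forall>v\<in>?S. w \<bullet> v = 0}"
  have "subspace W" by (auto simp: W_def subspace_def inner_add_left)
  moreover have "(transpose M ** M) *v w \<in> W" if "w \<in> W" for w
    unfolding W_def
  proof (intro CollectI ballI)
    fix v assume v: "v \<in> ?S"
    then obtain s where s: "(transpose M ** M) *v v = s\<^sup>2 *\<^sub>R v"
      by (auto simp: right_singular_space_def)
    have "((transpose M ** M) *v w) \<bullet> v = ((transpose M ** M) *v v) \<bullet> w"
      unfolding inner_gram by (rule inner_commute)
    also have "\<dots> = s\<^sup>2 * (w \<bullet> v)" unfolding s by (simp add: inner_commute)
    also have "w \<bullet> v = 0" using that v unfolding W_def by blast
    finally show "((transpose M ** M) *v w) \<bullet> v = 0" by simp
  qed
  moreover have "a \<in> W" using a(2) span_base[of _ ?S] unfolding W_def by blast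
  ultimately obtain \<mu> v where v: "0 \<le> \<mu>" "v \<in> W" "v \<noteq> 0" "(transpose M ** M) *v v = \<mu> *\<^sub>R v"
    using a(1) by (elim least_eigenvalue_exists)
  have "v \<in> right_singular_space M (sqrt \<mu>)" using v by (simp add: right_singular_space_def)
  moreover from this have "sqrt \<mu> \<in> singular_value_set M"
    using v(1,3) unfolding singular_value_set_def by auto
  ultimately have "v \<in> ?S" by blast
  then have "v \<bullet> v = 0" using v(2) unfolding W_def by blast
  then show False using v(3) by simp
qed

text \<open>Orthonormal bases of the eigenspaces combine to one orthonormal, hence independent,
  family \<open>U\<close>. It spans the space by the preceding lemma, so its size is the
  dimension.\<close>

lemma
  fixes M :: "real^'c^'r"
  shows finite_singular_value_set: "finite (singular_value_set M)"
    and sum_dim_right_singular_space: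
      "(\<Sum>s\<in>singular_value_set M. dim (right_singular_space M s)) = CARD('c)"
proof -
  define E where "E = singular_value_set M"
  have "\<exists>B. B \<subseteq> right_singular_space M s \<and> pairwise orthogonal B \<and> (\<forall>x\<in>B. norm x = 1)
      \<and> card B = dim (right_singular_space M s) \<and> span B = right_singular_space M s" for s
    by (rule orthonormal_basis_subspace[OF right_singular_space_subspace[of M s]]) blast
  then obtain B where B: "\<And>s. B s \<subseteq> right_singular_space M s" "\<And>s. pairwise orthogonal (B s)"
      "\<And>s x. x \<in> B s \<Longrightarrow> norm x = 1" "\<And>s. card (B s) = dim (right_singular_space M s)"
      "\<And>s. span (B s) = right_singular_space M s"
    by metis
  define U where "U = (\<Union>s\<in>E. B s)"
  have orth: "x \<bullet> y = 0" if "x \<in> B s" "y \<in> B t" "s \<in> E" "t \<in> E" "s \<noteq> t" for x y s t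
    using that B(1) right_singular_space_orthogonal[of x M s y t]
    by (auto simp: E_def singular_value_set_def)
  have "pairwise orthogonal U"
    unfolding pairwise_def U_def
  proof (intro ballI impI)
    fix x y assume "x \<in> (\<Union>s\<in>E. B s)" "y \<in> (\<Union>s\<in>E. B s)" "x \<noteq> y"
    then obtain s t where st: "s \<in> E" "t \<in> E" "x \<in> B s" "y \<in> B t" by blast
    show "orthogonal x y"
    proof (cases "s = t")
      case True
      then show ?thesis using B(2)[of s] st \<open>x \<noteq> y\<close> by (auto simp: pairwise_def)
    next
      case False
      then show ?thesis using orth st by (auto simp: orthogonal_def)
    qed
  qed
  moreover have "0 \<notin> U" using B(3) by (force simp: U_def)
  ultimately have ind: "independent U" by (rule pairwise_orthogonal_independent)
  then have fin: "finite U" by (rule independent_imp_finite)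
  have finB: "finite (B s)" if "s \<in> E" for s
    using fin that by (auto simp: U_def intro: finite_subset)
  have disj: "B s \<inter> B t = {}" if "s \<in> E" "t \<in> E" "s \<noteq> t" for s t
    using orth[OF _ _ that] B(3) by (force simp: disjoint_iff)
  \<comment> \<open>Nonempty pairwise disjoint sets are distinct, so \<open>B\<close> embeds
    \<open>E\<close> into the finite set \<open>Pow U\<close>.\<close>
  have "B s \<noteq> {}" if "s \<in> E" for s
  proof
    assume "B s = {}"
    then have "right_singular_space M s = {0}" using B(5)[of s] by simp
    then show False using that by (auto simp: E_def singular_value_set_def)
  qed
  then have "inj_on B E" using disj by (auto simp: inj_on_def) (metis Int_absorb)
  moreover have "B ` E \<subseteq> Pow U" by (auto simp: U_def)
  ultimately show finE: "finite (singular_value_set M)"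
    unfolding E_def[symmetric] using fin by (meson finite_Pow_iff inj_on_finite)
  have "span U = UNIV"
  proof -
    have "(\<Union>s\<in>E. right_singular_space M s) \<subseteq> span U"
      using B(5) by (metis SUP_least U_def Union_upper image_eqI span_mono UN_upper)
    then have "span (\<Union>s\<in>E. right_singular_space M s) \<subseteq> span U"
      by (simp add: span_minimal)
    then show ?thesis using span_right_singular_spaces[of M] by (auto simp: E_def)
  qed
  then have "card U = CARD('c)"
    using dim_eq_card_independent[OF ind] by (metis dim_UNIV dim_span DIM_cart DIM_real mult.right_neutral)
  moreover have "card U = (\<Sum>s\<in>E. card (B s))"
    unfolding U_def using finE finB disj by (intro card_UN_disjoint) (auto simp: E_def)
  ultimately show "(\<Sum>s\<in>singular_value_set M. dim (right_singular_space M s)) = CARD('c)"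
    by (simp add: B(4) E_def)
qed

section \<open>The end of the list of singular values\<close>

lemma length_singular_values: "length (singular_values M) = CARD('c)"
  for M :: "real^'c^'r"
proof -
  let ?L = "rev (sorted_list_of_set (singular_value_set M))"
  have "length (singular_values M) = (\<Sum>s\<leftarrow>?L. dim (right_singular_space M s))"
    unfolding singular_values_def singular_value_set_def[symmetric]
    by (simp add: length_concat comp_def)
  also have "\<dots> = (\<Sum>s\<in>set ?L. dim (right_singular_space M s))"
    by (rule sum_list_distinct_conv_sum_set) simp
  also have "\<dots> = CARD('c)"
    using finite_singular_value_set[of M] sum_dim_right_singular_space[of M] by simp
  finally show ?thesis .
qed

text \<open>Reversing the increasing list moves its head, the minimum \<open>s0\<close>, to the end,
  where it is repeated according to its multiplicity.\<close>

lemma singular_values_split: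
  fixes M :: "real^'c^'r"
  obtains s0 L where "s0 \<in> singular_value_set M" "\<And>s. s \<in> singular_value_set M \<Longrightarrow> s0 \<le> s"
    "set L \<subseteq> singular_value_set M - {s0}"
    "singular_values M = L @ replicate (dim (right_singular_space M s0)) s0"
    "dim (right_singular_space M s0) > 0"
proof -
  let ?E = "singular_value_set M"
  note fin = finite_singular_value_set[of M]
  have ne: "?E \<noteq> {}" using sum_dim_right_singular_space[of M] by auto
  define s0 where "s0 = Min ?E"
  have s0: "s0 \<in> ?E" "\<And>s. s \<in> ?E \<Longrightarrow> s0 \<le> s" unfolding s0_def using fin ne by auto
  define L where "L = concat (map (\<lambda>s. replicate (dim (right_singular_space M s)) s)
     (rev (sorted_list_of_set (?E - {s0}))))"
  have "sorted_list_of_set ?E = s0 # sorted_list_of_set (?E - {s0})"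
    unfolding s0_def using fin ne by (rule sorted_list_of_set_nonempty)
  then have "singular_values M = L @ replicate (dim (right_singular_space M s0)) s0"
    unfolding singular_values_def singular_value_set_def[symmetric] L_def by simp
  moreover have "set L \<subseteq> ?E - {s0}" unfolding L_def using fin by auto
  moreover have "dim (right_singular_space M s0) > 0"
    using s0(1) by (auto simp: singular_value_set_def intro!: Nat.gr0I)
  ultimately show thesis using s0 that by blast
qed

text \<open>The working description of the smallest singular value. For the Rayleigh bound, the
  minimum \<open>\<mu>\<close> of the quotient over the whole space is an eigenvalue, so
  \<open>sqrt \<mu>\<close> is a singular value and cannot lie below \<open>s\<close>.\<close>

lemma last_singular_value:
  fixes M :: "real^'c^'r"
  defines "s \<equiv> singular_value M CARD('c)"
  shows "0 \<le> s" "\<exists>v. v \<noteq> 0 \<and> (transpose M ** M) *v v = s\<^sup>2 *\<^sub>R v"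
    "s\<^sup>2 * (norm w)\<^sup>2 \<le> (norm (M *v w))\<^sup>2"
proof -
  obtain s0 L where s0: "s0 \<in> singular_value_set M" "\<And>s. s \<in> singular_value_set M \<Longrightarrow> s0 \<le> s"
    "singular_values M = L @ replicate (dim (right_singular_space M s0)) s0"
    "dim (right_singular_space M s0) > 0"
    by (rule singular_values_split[of M]) blast
  have "s = last (singular_values M)"
    unfolding s_def singular_value_def using length_singular_values[of M]
    by (metis last_conv_nth list.size(3) zero_less_card_finite less_irrefl)
  also have "\<dots> = s0"
  proof -
    have "replicate (dim (right_singular_space M s0)) s0 \<noteq> []"
      using s0(4) unfolding replicate_empty by linarith
    then show ?thesis unfolding s0(3) by (metis last_appendR last_replicate replicate_empty)
  qed
  finally have s: "s = s0" .
  show "0 \<le> s" and "\<exists>v. v \<noteq> 0 \<and> (transpose M ** M) *v v = s\<^sup>2 *\<^sub>R v"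
    using s0(1) unfolding s singular_value_set_def right_singular_space_def by auto
  obtain w0 :: "real^'c" where "w0 \<noteq> 0" using vector_choose_size[of 1] by fastforce
  then obtain \<mu> v where v: "0 \<le> \<mu>" "v \<noteq> 0" "(transpose M ** M) *v v = \<mu> *\<^sub>R v"
    "\<And>w. \<mu> * (norm w)\<^sup>2 \<le> (norm (M *v w))\<^sup>2"
    using least_eigenvalue_exists[of UNIV M w0] by (metis UNIV_I subspace_UNIV)
  have "s \<le> sqrt \<mu>" unfolding s using v
    by (intro s0(2)) (auto simp: singular_value_set_def right_singular_space_def)
  then have "s\<^sup>2 \<le> \<mu>" using \<open>0 \<le> s\<close> v(1) by (metis real_le_rsqrt real_sqrt_le_iff power_mono real_sqrt_pow2)
  then show "s\<^sup>2 * (norm w)\<^sup>2 \<le> (norm (M *v w))\<^sup>2"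
    using v(4)[of w] by (meson mult_right_mono order_trans zero_le_power2)
qed

text \<open>If the smallest value is simple (\<open>d = 1\<close>), the vectors come from different
  eigenspaces; otherwise the last two values coincide and both vectors come from an orthonormal
  basis of one eigenspace.\<close>

lemma last_two_singular_vectors:
  fixes M :: "real^'c^'r"
  defines "n \<equiv> CARD('c)"
  assumes "n \<ge> 2"
  obtains v w where "v \<noteq> 0" "w \<noteq> 0" "v \<bullet> w = 0"
    "(transpose M ** M) *v v = (singular_value M (n - 1))\<^sup>2 *\<^sub>R v"
    "(transpose M ** M) *v w = (singular_value M n)\<^sup>2 *\<^sub>R w"
    "singular_value M n \<le> singular_value M (n - 1)"
proof -
  obtain s0 L where s0: "s0 \<in> singular_value_set M" "\<And>s. s \<in> singular_value_set M \<Longrightarrow> s0 \<le> s"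
    "set L \<subseteq> singular_value_set M - {s0}"
    "singular_values M = L @ replicate (dim (right_singular_space M s0)) s0"
    "dim (right_singular_space M s0) > 0"
    by (rule singular_values_split[of M]) blast
  define d where "d = dim (right_singular_space M s0)"
  have n: "length L + d = n"
    using length_singular_values[of M] by (simp add: s0(4) n_def d_def)
  have d: "d > 0" using s0(5) d_def by simp
  have sn: "singular_value M n = s0"
  proof -
    have "\<not> n - 1 < length L" "n - 1 - length L < d" using n d by linarith+
    then show ?thesis
      unfolding singular_value_def s0(4) d_def[symmetric] nth_append by simp
  qed
  show thesis
  proof (cases "d = 1")
    case True
    \<comment> \<open>Singular values are counted from 1, so this is list index
      \<open>n - 2\<close>, the last one in \<open>L\<close>, whose length is
      \<open>n - 1\<close>.\<close>
    then have "singular_value M (n - 1) = L ! (n - 2)" "n - 2 < length L"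
      using n assms(2) unfolding singular_value_def s0(4) d_def[symmetric]
      by (auto simp: nth_append numeral_2_eq_2)
    then have E: "singular_value M (n - 1) \<in> singular_value_set M - {s0}"
      using s0(3) nth_mem by fastforce
    obtain v w where vw: "v \<noteq> 0" "w \<noteq> 0" "v \<in> right_singular_space M (singular_value M (n - 1))"
      "w \<in> right_singular_space M s0"
      using E s0(1) by (auto simp: singular_value_set_def)
    have "v \<bullet> w = 0"
      using right_singular_space_orthogonal[OF vw(3,4)] E s0(1)
      by (auto simp: singular_value_set_def)
    then show thesis using vw E s0(2) that[of v w] by (auto simp: sn right_singular_space_def)
  next
    case False
    then have "d \<ge> 2" using d by simp
    then have sn1: "singular_value M (n - 1) = s0"
    proof -
      have "\<not> n - 1 - 1 < length L" "n - 1 - 1 - length L < d" using n \<open>d \<ge> 2\<close> by linarith+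
      then show ?thesis
        unfolding singular_value_def s0(4) d_def[symmetric] nth_append by simp
    qed
    obtain B where B: "B \<subseteq> right_singular_space M s0" "pairwise orthogonal B"
      "\<And>x. x \<in> B \<Longrightarrow> norm x = 1" "card B = dim (right_singular_space M s0)"
      by (rule orthonormal_basis_subspace[OF right_singular_space_subspace[of M s0]]) blast
    have "2 \<le> card B" using B(4) \<open>d \<ge> 2\<close> d_def by simp
    then obtain v w where vw: "v \<in> B" "w \<in> B" "v \<noteq> w"
      by (metis card_le_Suc_iff numeral_2_eq_2 insertI1 insert_iff)
    then have "v \<bullet> w = 0" using B(2) by (auto simp: pairwise_def orthogonal_def)
    moreover have "v \<noteq> 0" "w \<noteq> 0" using B(3)[of v] B(3)[of w] vw by auto
    moreover have "(transpose M ** M) *v v = s0\<^sup>2 *\<^sub>R v" "(transpose M ** M) *v w = s0\<^sup>2 *\<^sub>R w"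
      using vw B(1) unfolding right_singular_space_def by auto
    ultimately show thesis using that[of v w] unfolding sn sn1 by blast
  qed
qed

subsection \<open>Matrix norms and the matrix \<open>[A b]\<close>\<close>

text \<open>Cauchy-Schwarz in every row; \<open>norm A\<close> is the Frobenius norm.\<close>

lemma norm_matrix_vector_mult_le: "norm (A *v x) \<le> norm A * norm x"
  for A :: "real^'n^'m"
proof (rule power2_le_imp_le)
  have "(norm (A *v x))\<^sup>2 = (\<Sum>i\<in>UNIV. (A $ i \<bullet> x)\<^sup>2)"
    unfolding power2_norm_eq_inner
    by (simp add: inner_vec_def[of "A *v x"] matrix_vector_mul_component power2_eq_square)
  also have "\<dots> \<le> (\<Sum>i\<in>UNIV. (norm (A $ i))\<^sup>2 * (norm x)\<^sup>2)"
    by (intro sum_mono) (simp add: Cauchy_Schwarz_ineq power2_norm_eq_inner)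
  also have "\<dots> = (norm A * norm x)\<^sup>2"
    by (simp add: power_mult_distrib sum_distrib_right[symmetric] power2_norm_eq_inner inner_vec_def[of A])
  finally show "(norm (A *v x))\<^sup>2 \<le> (norm A * norm x)\<^sup>2" .
qed simp

lemma bounded_bilinear_matrix_vector_mult:
  "bounded_bilinear ((*v) :: real^'n^'m \<Rightarrow> real^'n \<Rightarrow> real^'m)"
  by (rule bounded_bilinear.intro)
    (auto simp: algebra_simps scaleR_matrix_vector_assoc
      intro!: exI[of _ 1] norm_matrix_vector_mult_le[THEN order_trans])

lemma norm_vector_matrix_mult_le: "norm (y v* A) \<le> norm y * norm A"
  for A :: "real^'n^'m"
proof -
  have "(norm (y v* A))\<^sup>2 = y \<bullet> (A *v (y v* A))"
    by (simp add: power2_norm_eq_inner dot_lmul_matrix)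
  also have "\<dots> \<le> norm y * (norm A * norm (y v* A))"
    by (meson norm_cauchy_schwarz norm_matrix_vector_mult_le mult_left_mono norm_ge_zero order_trans)
  finally show ?thesis
    by (cases "norm (y v* A) = 0")
      (auto simp: power2_eq_square mult.assoc[symmetric] mult_le_cancel_right simp del: norm_eq_zero)
qed

lemma bounded_bilinear_vector_matrix_mult:
  "bounded_bilinear ((v*) :: real^'m \<Rightarrow> real^'n^'m \<Rightarrow> real^'n)"
  by (rule bounded_bilinear.intro)
    (auto simp: algebra_simps scaleR_vector_matrix_assoc vector_scaleR_matrix_ac
      intro!: exI[of _ 1] norm_vector_matrix_mult_le[THEN order_trans])

lemma transpose_mult_vector: "(transpose A ** A) *v z = (A *v z) v* A"
  for A :: "real^'n^'m"
  by (simp flip: matrix_vector_mul_assoc)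

text \<open>Test \<open>M\<close> on the last right singular vector \<open>v\<close> of
  \<open>N\<close>: there \<open>norm (N *v v)\<close> equals \<open>?t * norm v\<close>, while
  \<open>norm (M *v v)\<close> is at least \<open>?s * norm v\<close>.\<close>

lemma last_singular_value_mono:
  fixes M N :: "real^'c^'r"
  shows "singular_value M CARD('c) \<le> singular_value N CARD('c) + norm (M - N)"
proof -
  let ?s = "singular_value M CARD('c)" and ?t = "singular_value N CARD('c)"
  obtain v where v: "v \<noteq> 0" "(transpose N ** N) *v v = ?t\<^sup>2 *\<^sub>R v"
    using last_singular_value(2)[of N] by blast
  have "(norm (N *v v))\<^sup>2 = (?t * norm v)\<^sup>2"
    using inner_gram[of N v v] by (simp add: v(2) power_mult_distrib power2_norm_eq_inner)
  then have N: "norm (N *v v) = ?t * norm v"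
    using last_singular_value(1)[of N] by simp
  have "(?s * norm v)\<^sup>2 \<le> (norm (M *v v))\<^sup>2"
    using last_singular_value(3)[of M v] by (simp add: power_mult_distrib)
  then have "?s * norm v \<le> norm (M *v v)" by (rule power2_le_imp_le) simp
  also have "\<dots> = norm (N *v v + (M - N) *v v)" by (simp add: algebra_simps)
  also have "\<dots> \<le> ?t * norm v + norm (M - N) * norm v"
    by (rule norm_triangle_le) (simp add: N norm_matrix_vector_mult_le)
  finally have "?s * norm v \<le> (?t + norm (M - N)) * norm v" by (simp add: algebra_simps)
  then show ?thesis using v(1) by simp
qed

lemma last_singular_value_lipschitz:
  "\<bar>singular_value M CARD('c) - singular_value N CARD('c)\<bar> \<le> norm (M - N)"
  for M N :: "real^'c^'r"
  using last_singular_value_mono[of M N] last_singular_value_mono[of N M]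
  by (simp add: norm_minus_commute)

lemma continuous_last_singular_value:
  fixes F :: "'a::t2_space \<Rightarrow> real^'c^'r"
  assumes "isCont F a"
  shows "isCont (\<lambda>y. singular_value (F y) CARD('c)) a"
proof -
  have "((\<lambda>y. norm (F y - F a)) \<longlongrightarrow> 0) (at a)"
    using assms unfolding isCont_def by (metis LIM_zero tendsto_norm_zero)
  then have "((\<lambda>y. singular_value (F y) CARD('c) - singular_value (F a) CARD('c)) \<longlongrightarrow> 0) (at a)"
    by (rule Lim_null_comparison[rotated]) (simp add: last_singular_value_lipschitz)
  then show ?thesis unfolding isCont_def by (rule LIM_zero_cancel)
qed

section \<open>Block vectors with one appended entry, matching the columns of
  \<open>append_col\<close>\<close>

definition vec_append :: "real^'n \<Rightarrow> real \<Rightarrow> real^('n option)" where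
  "vec_append z \<tau> = (\<chi> k. case k of Some j \<Rightarrow> z $ j | None \<Rightarrow> \<tau>)"

lemma sum_UNIV_option: "(\<Sum>k\<in>UNIV. f k) = f None + (\<Sum>j\<in>UNIV. f (Some j))"
  for f :: "'n::finite option \<Rightarrow> 'a::comm_monoid_add"
  by (simp add: UNIV_option_conv sum.reindex)

lemma vec_append_cases:
  obtains z \<tau> where "v = vec_append z \<tau>"
proof
  show "v = vec_append (\<chi> j. v $ Some j) (v $ None)"
    by (auto simp: vec_append_def vec_eq_iff split: option.split)
qed

lemma vec_append_eq_iff: "vec_append z \<tau> = vec_append z' \<tau>' \<longleftrightarrow> z = z' \<and> \<tau> = \<tau>'"
  by (auto simp: vec_append_def vec_eq_iff split: option.splits)

lemma vec_append_eq_0_iff: "vec_append z \<tau> = 0 \<longleftrightarrow> z = 0 \<and> \<tau> = 0"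
  by (auto simp: vec_append_def vec_eq_iff split: option.splits)

lemma scaleR_vec_append: "c *\<^sub>R vec_append z \<tau> = vec_append (c *\<^sub>R z) (c * \<tau>)"
  by (auto simp: vec_append_def vec_eq_iff split: option.splits)

lemma inner_vec_append: "vec_append z \<tau> \<bullet> vec_append z' \<tau>' = z \<bullet> z' + \<tau> * \<tau>'"
  by (simp add: inner_vec_def sum_UNIV_option vec_append_def)

lemma norm_vec_append: "(norm (vec_append z \<tau>))\<^sup>2 = (norm z)\<^sup>2 + \<tau>\<^sup>2"
  unfolding power2_norm_eq_inner inner_vec_append by (simp add: power2_eq_square)

lemma append_col_mult_vec_append: "append_col A b *v vec_append z \<tau> = A *v z + \<tau> *\<^sub>R b"
  by (simp add: vec_eq_iff matrix_vector_mult_def sum_UNIV_option vec_append_def append_col_def)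

lemma mult_append_col: "y v* append_col A b = vec_append (y v* A) (y \<bullet> b)"
  by (auto simp: vec_eq_iff vector_matrix_mult_def vec_append_def append_col_def inner_vec_def
      mult.commute split: option.split)

text \<open>Splits the eigenvector equation of \<open>[A b]\<close> into its first \<open>n\<close>
  components and its last one. For \<open>(x, -1)\<close> and eigenvalue \<open>\<lambda>\<close>
  they read \<open>(A *v x - b) v* A = \<lambda> *\<^sub>R x\<close> and
  \<open>(A *v x - b) \<bullet> b = - \<lambda>\<close>.\<close>

lemma gram_append_col:
  "(transpose (append_col A b) ** append_col A b) *v vec_append z \<tau>
    = vec_append ((A *v z + \<tau> *\<^sub>R b) v* A) ((A *v z + \<tau> *\<^sub>R b) \<bullet> b)"
  by (simp add: transpose_mult_vector append_col_mult_vec_append mult_append_col)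

lemma append_col_row: "append_col A b $ i = vec_append (A $ i) (b $ i)"
  by (simp add: append_col_def vec_append_def)

lemma norm_append_col: "(norm (append_col E r))\<^sup>2 = (norm E)\<^sup>2 + (norm r)\<^sup>2"
  by (simp add: power2_norm_eq_inner inner_vec_def[of "append_col E r"] inner_vec_def[of E]
      inner_vec_def[of r] append_col_row inner_vec_append sum.distrib)

lemma isCont_append_col:
  fixes A :: "'a::t2_space \<Rightarrow> real^'n^'m"
  assumes "isCont A a" "isCont b a"
  shows "isCont (\<lambda>y. append_col (A y) (b y)) a"
  unfolding isCont_def
proof (intro vec_tendstoI)
  fix i k
  show "(\<lambda>y. append_col (A y) (b y) $ i $ k) \<midarrow>a\<rightarrow> append_col (A a) (b a) $ i $ k"
    using assms unfolding isCont_def append_col_def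
    by (cases k) (auto intro!: tendsto_intros)
qed

subsection \<open>The total least squares solution\<close>

definition tls_sv :: "real^'n^'m \<Rightarrow> real^'m \<Rightarrow> real" where
  "tls_sv A b = singular_value (append_col A b) (CARD('n) + 1)"

text \<open>The hypothesis on the singular values as a predicate on data, since it is also used at
  the perturbed data.\<close>

definition tls_generic :: "real^'n^'m \<Rightarrow> real^'m \<Rightarrow> bool" where
  "tls_generic A b \<longleftrightarrow> tls_sv A b < singular_value A CARD('n)"

lemma tls_sv_eq: "tls_sv A b = singular_value (append_col A b) CARD('n option)"
  for A :: "real^'n^'m"
  by (simp add: tls_sv_def)

lemma tls_sv_nonneg: "0 \<le> tls_sv A b"
  unfolding tls_sv_eq by (rule last_singular_value)

lemma tls_sv_eigenvector:
  obtains z \<tau> where "z \<noteq> 0 \<or> \<tau> \<noteq> 0" "(A *v z + \<tau> *\<^sub>R b) v* A = (tls_sv A b)\<^sup>2 *\<^sub>R z"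
    "(A *v z + \<tau> *\<^sub>R b) \<bullet> b = (tls_sv A b)\<^sup>2 * \<tau>"
proof -
  obtain v where v: "v \<noteq> 0"
    "(transpose (append_col A b) ** append_col A b) *v v = (tls_sv A b)\<^sup>2 *\<^sub>R v"
    using last_singular_value(2)[of "append_col A b"] unfolding tls_sv_eq by blast
  obtain z \<tau> where z: "v = vec_append z \<tau>" by (rule vec_append_cases)
  show thesis
    using v that[of z \<tau>] unfolding z gram_append_col scaleR_vec_append vec_append_eq_iff vec_append_eq_0_iff
    by blast
qed

lemma tls_generic_pos: "tls_generic A b \<Longrightarrow> 0 < (singular_value A CARD('n))\<^sup>2 - (tls_sv A b)\<^sup>2"
  for A :: "real^'n^'m"
  using power_strict_mono[of "tls_sv A b" "singular_value A CARD('n)" 2] tls_sv_nonneg[of A b]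
  by (simp add: tls_generic_def)

lemma gram_shift_mult: "(transpose A ** A - c *\<^sub>R mat 1) *v z = (A *v z) v* A - c *\<^sub>R z"
  for A :: "real^'n^'m"
  by (simp add: matrix_vector_mult_diff_rdistrib transpose_mult_vector flip: scaleR_matrix_vector_assoc)

text \<open>Positivity of the form gives injectivity, and an injective square matrix has a two-sided
  inverse.\<close>

lemma posdef_matrix_inv:
  fixes P :: "real^'n^'n"
  assumes "\<And>w. w \<noteq> 0 \<Longrightarrow> 0 < (P *v w) \<bullet> w"
  shows "matrix_inv P *v (P *v z) = z" "P *v (matrix_inv P *v z) = z"
proof -
  have "inj ((*v) P)"
  proof (rule injI)
    fix v w assume "P *v v = P *v w"
    then have "P *v (v - w) = 0" by (simp add: matrix_vector_mult_diff_distrib)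
    then show "v = w" using assms[of "v - w"] by auto
  qed
  then have "\<exists>B. P ** B = mat 1 \<and> B ** P = mat 1"
    using matrix_left_invertible_injective[of P] matrix_left_right_inverse by blast
  then have *: "P ** matrix_inv P = mat 1 \<and> matrix_inv P ** P = mat 1"
    unfolding matrix_inv_def by (rule someI_ex)
  show "matrix_inv P *v (P *v z) = z" "P *v (matrix_inv P *v z) = z"
    using * by (simp_all add: matrix_vector_mul_assoc)
qed

text \<open>The quadratic form of \<open>P\<close> at \<open>w\<close> is
  \<open>(norm (A *v w))^2 - \<lambda> * (norm w)^2\<close>. For generic data the constant is
  positive, which yields the inverse of \<open>P\<close>, the bound on the solution and its
  continuity.\<close>

lemma tls_coercive:
  fixes A :: "real^'n^'m"
  shows "((singular_value A CARD('n))\<^sup>2 - (tls_sv A b)\<^sup>2) * (norm w)\<^sup>2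
    \<le> ((A *v w) v* A - (tls_sv A b)\<^sup>2 *\<^sub>R w) \<bullet> w"
  using last_singular_value(3)[of A w]
  by (simp add: inner_diff_left dot_lmul_matrix power2_norm_eq_inner algebra_simps)

lemma tls_matrix_inv:
  fixes A :: "real^'n^'m"
  assumes "tls_generic A b"
  defines "P \<equiv> transpose A ** A - (tls_sv A b)\<^sup>2 *\<^sub>R mat 1"
  shows "matrix_inv P *v (P *v z) = z" "P *v (matrix_inv P *v z) = z"
proof -
  have "0 < (P *v w) \<bullet> w" if "w \<noteq> 0" for w
    unfolding P_def gram_shift_mult
    by (rule order.strict_trans2[OF _ tls_coercive])
      (use tls_generic_pos[OF assms(1)] that in simp)
  from posdef_matrix_inv[of P, OF this]
  show "matrix_inv P *v (P *v z) = z" "P *v (matrix_inv P *v z) = z" by blast+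
qed

text \<open>The equation is a rearrangement of \<open>P *v z = b v* A\<close>, and \<open>P\<close>
  is invertible.\<close>

lemma tls_formula_unique:
  fixes A :: "real^'n^'m"
  assumes "tls_generic A b" "(A *v z - b) v* A = (tls_sv A b)\<^sup>2 *\<^sub>R z"
  shows "tls_formula A b = z"
proof -
  have "(transpose A ** A - (tls_sv A b)\<^sup>2 *\<^sub>R mat 1) *v z = b v* A"
    unfolding gram_shift_mult using assms(2) by (simp add: algebra_simps)
  then show ?thesis
    using tls_matrix_inv(1)[OF assms(1), of z]
    by (simp add: tls_formula_def tls_sv_def)
qed

text \<open>Some eigenvector \<open>(z, \<tau>)\<close> for the smallest eigenvalue exists. Scaled
  to last component -1 it satisfies the equation characterising \<open>tls_formula\<close>, and its
  last component gives the second claim.\<close>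

lemma tls_formula_eigenvector:
  fixes A :: "real^'n^'m"
  assumes "tls_generic A b"
  defines "g \<equiv> tls_formula A b"
  shows "(A *v g - b) v* A = (tls_sv A b)\<^sup>2 *\<^sub>R g" "(A *v g - b) \<bullet> b = - (tls_sv A b)\<^sup>2"
proof -
  obtain z \<tau> where z: "z \<noteq> 0 \<or> \<tau> \<noteq> 0" "(A *v z + \<tau> *\<^sub>R b) v* A = (tls_sv A b)\<^sup>2 *\<^sub>R z"
    "(A *v z + \<tau> *\<^sub>R b) \<bullet> b = (tls_sv A b)\<^sup>2 * \<tau>"
    by (rule tls_sv_eigenvector)
  \<comment> \<open>Otherwise \<open>z\<close> would be a nonzero kernel vector of the positive
    definite matrix \<open>P\<close>.\<close>
  have "\<tau> \<noteq> 0"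
  proof
    assume "\<tau> = 0"
    then have "((singular_value A CARD('n))\<^sup>2 - (tls_sv A b)\<^sup>2) * (norm z)\<^sup>2 \<le> 0"
      using tls_coercive[of A b z] z(2) by simp
    then have "z = 0" using tls_generic_pos[OF assms(1)] by (simp add: mult_le_0_iff)
    then show False using \<open>\<tau> = 0\<close> z(1) by simp
  qed
  define y where "y = (- 1 / \<tau>) *\<^sub>R z"
  have y: "A *v y - b = (- 1 / \<tau>) *\<^sub>R (A *v z + \<tau> *\<^sub>R b)"
    unfolding y_def matrix_vector_mult_scaleR scaleR_add_right using \<open>\<tau> \<noteq> 0\<close> by simp
  have e: "(A *v y - b) v* A = (tls_sv A b)\<^sup>2 *\<^sub>R y"
    unfolding y by (simp only: scaleR_vector_matrix_assoc z(2)) (simp add: y_def)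
  have "g = y" unfolding g_def by (rule tls_formula_unique[OF assms(1) e])
  moreover have "(A *v y - b) \<bullet> b = - (tls_sv A b)\<^sup>2"
    unfolding y inner_scaleR_left z(3) using \<open>\<tau> \<noteq> 0\<close> by simp
  ultimately show "(A *v g - b) v* A = (tls_sv A b)\<^sup>2 *\<^sub>R g" "(A *v g - b) \<bullet> b = - (tls_sv A b)\<^sup>2"
    using e by auto
qed

text \<open>Pair the eigenvector equation of \<open>(g, -1)\<close> with an arbitrary
  \<open>(z, -1)\<close>. Taking \<open>z = g\<close> gives the size of the residual; taking the
  solution for other data gives the change of the eigenvalue.\<close>

lemma tls_residual_inner:
  fixes A :: "real^'n^'m"
  assumes "tls_generic A b"
  defines "g \<equiv> tls_formula A b"
  shows "(A *v g - b) \<bullet> (A *v z - b) = (tls_sv A b)\<^sup>2 * (1 + g \<bullet> z)"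
  using tls_formula_eigenvector[OF assms(1), folded g_def]
  by (simp add: inner_diff_right dot_lmul_matrix[symmetric] algebra_simps)

text \<open>The rank-one matrix \<open>a c\<^sup>T\<close>, the form of the optimal correction
  \<open>E\<close> and of the matrix part of the adjoint.\<close>

definition outer :: "real^'m \<Rightarrow> real^'n \<Rightarrow> real^'n^'m" where
  "outer a c = (\<chi> i. a $ i *\<^sub>R c)"

lemma inner_outer: "X \<bullet> outer a c = (X *v c) \<bullet> a"
  by (simp add: inner_vec_def[of X] inner_vec_def[of _ a] outer_def matrix_vector_mul_component mult.commute)

lemma outer_mult: "outer a c *v z = (c \<bullet> z) *\<^sub>R a"
  by (simp add: vec_eq_iff matrix_vector_mul_component outer_def mult.commute)

lemma norm_outer: "norm (outer a c) = norm a * norm c"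
proof (rule power2_eq_imp_eq)
  show "(norm (outer a c))\<^sup>2 = (norm a * norm c)\<^sup>2"
    unfolding power2_norm_eq_inner power_mult_distrib inner_outer outer_mult by simp
qed simp_all

text \<open>An explicit feasible correction of norm \<open>tls_sv A b\<close> bounds the minimal
  one. Hence \<open>(x, -1)\<close> attains the least Rayleigh quotient of \<open>[A b]\<close>, is
  an eigenvector, and \<open>tls_formula_unique\<close> applies.\<close>

lemma tls_solution_eq_formula:
  fixes A :: "real^'n^'m"
  assumes gen: "tls_generic A b" and sol: "tls_solution A b x"
  shows "x = tls_formula A b"
proof -
  define g where "g = tls_formula A b"
  define \<rho> where "\<rho> = 1 + (norm g)\<^sup>2"
  have \<rho>: "\<rho> > 0" unfolding \<rho>_def by (simp add: add_pos_nonneg)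
  define q where "q = A *v g - b"
  have q: "(norm q)\<^sup>2 = (tls_sv A b)\<^sup>2 * \<rho>"
    using tls_residual_inner[OF gen, of g] unfolding g_def[symmetric] q_def \<rho>_def
    by (simp add: power2_norm_eq_inner)
  \<comment> \<open>Since \<open>b\<close> is changed by \<open>- r'\<close>, the correction
    \<open>[E' (- r')]\<close> equals \<open>- q v\<^sup>T / \<rho>\<close> with
    \<open>v = (g, -1)\<close>; as \<open>[A b] v = q\<close>, the corrected matrix annihilates
    \<open>v\<close>.\<close>
  define E' where "E' = (- 1 / \<rho>) *\<^sub>R outer q g"
  define r' where "r' = (- 1 / \<rho>) *\<^sub>R q"
  obtain E r where Er: "(A + E) *v x = b - r"
    and min: "\<And>E' r'. tls_feasible A b E' r' \<Longrightarrow> norm (append_col E r) \<le> norm (append_col E' r')"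
    using sol unfolding tls_solution_def by blast
  have E'r': "E' *v g + r' = - q"
  proof -
    have "E' *v g + r' = (- 1 / \<rho>) *\<^sub>R ((g \<bullet> g) *\<^sub>R q + q)"
      unfolding E'_def r'_def scaleR_matrix_vector_assoc[symmetric] outer_mult scaleR_add_right ..
    also have "(g \<bullet> g) *\<^sub>R q + q = \<rho> *\<^sub>R q"
      by (simp add: \<rho>_def power2_norm_eq_inner scaleR_left_distrib)
    finally show ?thesis using \<rho> by simp
  qed
  have "(A + E') *v g = b - r'"
    using E'r' by (simp add: q_def algebra_simps)
  then have "tls_feasible A b E' r'" unfolding tls_feasible_def by (metis rangeI)
  then have "(norm (append_col E r))\<^sup>2 \<le> (norm (append_col E' r'))\<^sup>2"
    using min by (simp add: power_mono)
  also have "\<dots> = (norm q)\<^sup>2 * (1 + (norm g)\<^sup>2) / \<rho>\<^sup>2"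
    by (simp add: norm_append_col E'_def r'_def norm_outer power_mult_distrib power_divide
        add_divide_distrib distrib_left)
  also have "\<dots> = (tls_sv A b)\<^sup>2"
    unfolding q \<rho>_def[symmetric] using \<rho> by (simp add: power2_eq_square)
  finally have le: "(norm (append_col E r))\<^sup>2 \<le> (tls_sv A b)\<^sup>2" .
  have "A *v x - b = - (append_col E r *v vec_append x 1)"
    using Er by (simp add: append_col_mult_vec_append algebra_simps)
  then have "norm (A *v x - b) \<le> norm (append_col E r) * norm (vec_append x 1)"
    by (simp add: norm_matrix_vector_mult_le)
  then have "(norm (A *v x - b))\<^sup>2 \<le> (norm (append_col E r) * norm (vec_append x 1))\<^sup>2"
    by (rule power_mono) simp
  also have "\<dots> = (norm (append_col E r))\<^sup>2 * ((norm x)\<^sup>2 + 1)"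
    by (simp add: power_mult_distrib norm_vec_append)
  also have "\<dots> \<le> (tls_sv A b)\<^sup>2 * ((norm x)\<^sup>2 + 1)"
    using le by (rule mult_right_mono) simp
  finally have x: "(norm (A *v x - b))\<^sup>2 \<le> (tls_sv A b)\<^sup>2 * ((norm x)\<^sup>2 + 1)" .
  have "(transpose (append_col A b) ** append_col A b) *v vec_append x (- 1)
      = (tls_sv A b)\<^sup>2 *\<^sub>R vec_append x (- 1)"
  proof (rule rayleigh_minimizer_eigenvector[OF subspace_UNIV])
    show "(norm (append_col A b *v vec_append x (- 1)))\<^sup>2 \<le> (tls_sv A b)\<^sup>2 * (norm (vec_append x (- 1)))\<^sup>2"
      using x by (simp add: append_col_mult_vec_append norm_vec_append)
    show "(tls_sv A b)\<^sup>2 * (norm w)\<^sup>2 \<le> (norm (append_col A b *v w))\<^sup>2" for w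
      unfolding tls_sv_eq by (rule last_singular_value)
  qed auto
  then have "(A *v x - b) v* A = (tls_sv A b)\<^sup>2 *\<^sub>R x"
    unfolding gram_append_col scaleR_vec_append vec_append_eq_iff by simp
  from tls_formula_unique[OF gen this] show ?thesis by simp
qed

subsection \<open>Differentiability\<close>

text \<open>A product rule in which the second factor need only be continuous, because the first
  vanishes at \<open>a\<close>. It differentiates terms containing the solution map before that map
  is known to be differentiable.\<close>

lemma has_derivative_vanishing_factor:
  assumes B: "bounded_bilinear B"
    and f: "(f has_derivative f') (at a)" "f a = 0" and h: "isCont h a"
  shows "((\<lambda>y. B (f y) (h y)) has_derivative (\<lambda>d. B (f' d) (h a))) (at a)"
proof -
  interpret bounded_bilinear B by (rule B)
  interpret f': bounded_linear f' using f(1) by (rule has_derivative_bounded_linear)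
  obtain K where K: "K > 0" "\<And>a b. norm (B a b) \<le> norm a * norm b * K"
    using pos_bounded by blast
  have 1: "((\<lambda>y. B (f y) (h a)) has_derivative (\<lambda>d. B (f' d) (h a))) (at a)"
    by (rule bounded_linear.has_derivative[OF bounded_linear_left f(1)])
  \<comment> \<open>\<open>norm (f y) / norm (y - a)\<close> stays bounded near \<open>a\<close>
    because \<open>f\<close> is differentiable and zero there, while \<open>h y - h a\<close> tends
    to 0.\<close>
  have "((\<lambda>y. B (f y) (h y - h a)) has_derivative (\<lambda>d. 0)) (at a)"
    unfolding has_derivative_at_within
  proof
    obtain L where L: "L > 0" "\<And>d. norm (f' d) \<le> norm d * L" using f'.pos_bounded by blast
    have "((\<lambda>y. norm ((f y - f a - f' (y - a)) /\<^sub>R norm (y - a))) \<longlongrightarrow> 0) (at a)"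
      using f(1) unfolding has_derivative_at_within by (metis tendsto_norm_zero)
    then have e: "((\<lambda>y. (norm ((f y - f a - f' (y - a)) /\<^sub>R norm (y - a)) + L) * norm (h y - h a) * K)
        \<longlongrightarrow> (0 + L) * 0 * K) (at a)"
      using h by (intro tendsto_intros) (auto simp: isCont_def intro: tendsto_norm_zero LIM_zero)
    have "((\<lambda>y. (B (f y) (h y - h a)) /\<^sub>R norm (y - a)) \<longlongrightarrow> 0) (at a)"
    proof (rule Lim_null_comparison)
      show "\<forall>\<^sub>F y in at a. norm ((B (f y) (h y - h a)) /\<^sub>R norm (y - a))
          \<le> (norm ((f y - f a - f' (y - a)) /\<^sub>R norm (y - a)) + L) * norm (h y - h a) * K"
        unfolding eventually_at_filter
      proof (intro always_eventually allI impI)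
        fix y assume "y \<noteq> a"
        then have n: "norm (y - a) > 0" by simp
        have "norm (f y) \<le> norm (f y - f a - f' (y - a)) + norm (f' (y - a))"
          using norm_triangle_ineq[of "f y - f a - f' (y - a)" "f' (y - a)"] by (simp add: f(2))
        then have "norm (f y) / norm (y - a)
            \<le> (norm (f y - f a - f' (y - a)) + norm (y - a) * L) / norm (y - a)"
          using L(2)[of "y - a"] by (intro divide_right_mono) auto
        also have "\<dots> = norm ((f y - f a - f' (y - a)) /\<^sub>R norm (y - a)) + L"
          unfolding norm_scaleR using n by (simp add: field_simps)
        finally have *: "norm (f y) / norm (y - a) \<le> \<dots>" .
        have "norm ((B (f y) (h y - h a)) /\<^sub>R norm (y - a))
            \<le> (norm (f y) * norm (h y - h a) * K) / norm (y - a)"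
          using K(2)[of "f y" "h y - h a"] n by (simp add: field_simps)
        also have "\<dots> = (norm (f y) / norm (y - a)) * norm (h y - h a) * K" by simp
        also have "\<dots> \<le> (norm ((f y - f a - f' (y - a)) /\<^sub>R norm (y - a)) + L) * norm (h y - h a) * K"
          using * K(1) by (intro mult_right_mono) auto
        finally show "norm ((B (f y) (h y - h a)) /\<^sub>R norm (y - a)) \<le> \<dots>" .
      qed
      show "((\<lambda>y. (norm ((f y - f a - f' (y - a)) /\<^sub>R norm (y - a)) + L) * norm (h y - h a) * K)
        \<longlongrightarrow> 0) (at a)" using e by simp
    qed
    then show "((\<lambda>y. (B (f y) (h y - h a) - B (f a) (h a - h a) - 0) /\<^sub>R norm (y - a)) \<longlongrightarrow> 0) (at a)"
      by (simp add: f(2) zero_left)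
  qed (rule bounded_linear_zero)
  from has_derivative_add[OF 1 this] show ?thesis by (simp add: diff_right)
qed

section \<open>The data vector and its coordinates\<close>

lemma data_mat_data_vec [simp]: "data_mat (data_vec A b) = A"
  by (simp add: data_mat_def data_vec_def vec_eq_iff)

lemma data_rhs_data_vec [simp]: "data_rhs (data_vec A b) = b"
  by (simp add: data_rhs_def data_vec_def vec_eq_iff)

lemma bounded_linear_data_mat: "bounded_linear data_mat"
  unfolding linear_conv_bounded_linear[symmetric]
  by (rule linearI) (simp_all add: data_mat_def vec_eq_iff)

lemma bounded_linear_data_rhs: "bounded_linear data_rhs"
  unfolding linear_conv_bounded_linear[symmetric]
  by (rule linearI) (simp_all add: data_rhs_def vec_eq_iff)

text \<open>The sum splits along the sum type of indices; the order of summation is swapped because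
  \<open>Inl (j, i)\<close> has the column first. On matrices the inner product is that of
  Frobenius.\<close>

lemma inner_data_vec: "y \<bullet> data_vec A b = data_mat y \<bullet> A + data_rhs y \<bullet> b"
proof -
  have "data_mat y \<bullet> A = (\<Sum>i\<in>UNIV. \<Sum>j\<in>UNIV. y $ Inl (j, i) * A $ i $ j)"
    by (simp add: inner_vec_def data_mat_def)
  also have "\<dots> = (\<Sum>j\<in>UNIV. \<Sum>i\<in>UNIV. y $ Inl (j, i) * A $ i $ j)" by (rule sum.swap)
  also have "\<dots> = (\<Sum>k\<in>UNIV. y $ Inl k * A $ snd k $ fst k)"
    by (simp add: sum.cartesian_product case_prod_beta)
  finally have A: "data_mat y \<bullet> A = \<dots>" .
  have "y \<bullet> data_vec A b = (\<Sum>k\<in>UNIV <+> UNIV. y $ k * data_vec A b $ k)"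
    by (simp add: inner_vec_def)
  also have "\<dots> = (\<Sum>k\<in>UNIV. y $ Inl k * A $ snd k $ fst k) + (\<Sum>i\<in>UNIV. y $ Inr i * b $ i)"
    by (subst sum.Plus) (simp_all add: data_vec_def case_prod_beta)
  also have "\<dots> = data_mat y \<bullet> A + data_rhs y \<bullet> b"
    unfolding A by (simp add: inner_vec_def data_rhs_def)
  finally show ?thesis .
qed

lemma norm_data_vec: "(norm (data_vec A b))\<^sup>2 = (norm A)\<^sup>2 + (norm b)\<^sup>2"
  by (simp add: power2_norm_eq_inner inner_data_vec)

text \<open>Test \<open>P *v g = b v* A\<close> with \<open>g\<close> and use coercivity. The bound
  depends continuously on the data, so solutions stay bounded nearby.\<close>

lemma norm_tls_formula_le:
  fixes A :: "real^'n^'m"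
  assumes "tls_generic A b"
  shows "norm (tls_formula A b) \<le> norm (b v* A) / ((singular_value A CARD('n))\<^sup>2 - (tls_sv A b)\<^sup>2)"
proof -
  define g where "g = tls_formula A b"
  let ?d = "(singular_value A CARD('n))\<^sup>2 - (tls_sv A b)\<^sup>2"
  have "?d * (norm g)\<^sup>2 \<le> ((A *v g) v* A - (tls_sv A b)\<^sup>2 *\<^sub>R g) \<bullet> g" by (rule tls_coercive)
  also have "(A *v g) v* A - (tls_sv A b)\<^sup>2 *\<^sub>R g = b v* A"
    using tls_formula_eigenvector(1)[OF assms] by (simp add: g_def algebra_simps)
  also have "(b v* A) \<bullet> g \<le> norm (b v* A) * norm g" by (rule norm_cauchy_schwarz)
  finally have "norm g * (norm g * ?d) \<le> norm g * norm (b v* A)"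
    by (simp add: power2_eq_square algebra_simps)
  then have "norm g * ?d \<le> norm (b v* A)"
    by (cases "g = 0") (auto simp: mult_le_cancel_left)
  then show ?thesis using tls_generic_pos[OF assms] by (simp add: g_def pos_le_divide_eq)
qed

text \<open>Exact identities without remainder. The first subtracts the two eigenvector equations,
  its left side being \<open>P *v (g - x)\<close>; the second subtracts two instances of
  \<open>tls_residual_inner\<close>, each taken at the solution for the other data.\<close>

lemma tls_perturbation:
  fixes A A1 :: "real^'n^'m"
  assumes "tls_generic A b" "tls_generic A1 b1"
  defines "x \<equiv> tls_formula A b" and "g \<equiv> tls_formula A1 b1"
    and "l \<equiv> (tls_sv A b)\<^sup>2" and "l1 \<equiv> (tls_sv A1 b1)\<^sup>2"
  shows "(A *v (g - x)) v* A - l *\<^sub>R (g - x)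
      = (b1 - b - (A1 - A) *v g) v* A + (b1 - A1 *v g) v* (A1 - A) + (l1 - l) *\<^sub>R g"
    and "(l1 - l) * (1 + g \<bullet> x)
      = (b1 - A1 *v g) \<bullet> (b1 - b - (A1 - A) *v x) + (b - A *v x) \<bullet> (b1 - b - (A1 - A) *v g)"
proof -
  note e = tls_formula_eigenvector(1)[OF assms(1), folded x_def l_def]
  note e1 = tls_formula_eigenvector(1)[OF assms(2), folded g_def l1_def]
  have "(A *v (g - x)) v* A - l *\<^sub>R (g - x) = (A *v g - b) v* A - l *\<^sub>R g"
    using e by (simp add: algebra_simps)
  also have "\<dots> = (b1 - b - (A1 - A) *v g) v* A + (b1 - A1 *v g) v* (A1 - A) + (l1 - l) *\<^sub>R g"
    using e1 by (simp add: algebra_simps)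
  finally show "(A *v (g - x)) v* A - l *\<^sub>R (g - x) = \<dots>" .
  have "l1 * (1 + g \<bullet> x) = (b1 - A1 *v g) \<bullet> (b1 - A1 *v x)"
    using tls_residual_inner[OF assms(2), of x]
    by (simp add: g_def l1_def inner_diff_left inner_diff_right)
  moreover have "l * (1 + g \<bullet> x) = (b - A *v x) \<bullet> (b - A *v g)"
    using tls_residual_inner[OF assms(1), of g]
    by (simp add: x_def l_def inner_diff_left inner_diff_right inner_commute)
  ultimately show "(l1 - l) * (1 + g \<bullet> x)
      = (b1 - A1 *v g) \<bullet> (b1 - b - (A1 - A) *v x) + (b - A *v x) \<bullet> (b1 - b - (A1 - A) *v g)"
    by (simp add: algebra_simps inner_diff_left inner_diff_right inner_commute)
qed

lemma isCont_data_mat: "isCont data_mat y"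
  by (rule linear_continuous_at[OF bounded_linear_data_mat])

lemma isCont_data_rhs: "isCont data_rhs y"
  by (rule linear_continuous_at[OF bounded_linear_data_rhs])

lemma isCont_tls_sv: "isCont (\<lambda>y. tls_sv (data_mat y) (data_rhs y)) y"
  unfolding tls_sv_eq
  by (intro continuous_last_singular_value isCont_append_col isCont_data_mat isCont_data_rhs)

lemma eventually_tls_generic:
  fixes A :: "real^'n^'m"
  assumes "tls_generic A b"
  shows "\<forall>\<^sub>F y in at (data_vec A b). tls_generic (data_mat y) (data_rhs y)"
proof -
  let ?y = "data_vec A b"
  have "isCont (\<lambda>y. singular_value (data_mat y :: real^'n^'m) CARD('n) - tls_sv (data_mat y) (data_rhs y)) ?y"
    by (intro continuous_intros continuous_last_singular_value isCont_data_mat isCont_tls_sv)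
  then have "\<forall>\<^sub>F y in at ?y. 0 < singular_value (data_mat y :: real^'n^'m) CARD('n) - tls_sv (data_mat y) (data_rhs y)"
    unfolding isCont_def by (rule order_tendstoD) (use assms in \<open>simp add: tls_generic_def\<close>)
  then show ?thesis by (simp add: tls_generic_def)
qed

text \<open>Coercivity and the first perturbation identity bound
  \<open>\<delta> * norm (g - x)\<close> by the norm of a right-hand side that tends to 0 once
  \<open>g\<close> is known to stay bounded.\<close>

lemma isCont_tls_map:
  fixes A :: "real^'n^'m"
  assumes gen: "tls_generic A b"
  shows "isCont tls_map (data_vec A b)"
proof -
  define y0 where "y0 = data_vec A b"
  have y0: "data_mat y0 = A" "data_rhs y0 = b" by (simp_all add: y0_def)
  note ev = eventually_tls_generic[OF gen, folded y0_def]
  have lims: "(data_mat \<longlongrightarrow> A) (at y0)" "(data_rhs \<longlongrightarrow> b) (at y0)"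
    using isCont_data_mat[of y0] isCont_data_rhs[of y0] unfolding isCont_def y0 by auto
  have sv: "((\<lambda>y. tls_sv (data_mat y) (data_rhs y)) \<longlongrightarrow> tls_sv A b) (at y0)"
    using isCont_tls_sv[of y0] unfolding isCont_def y0 .
  have svA: "((\<lambda>y. singular_value (data_mat y) CARD('n)) \<longlongrightarrow> singular_value A CARD('n)) (at y0)"
    using continuous_last_singular_value[OF isCont_data_mat[of y0]] unfolding isCont_def y0 .
  define \<delta> where "\<delta> = (singular_value A CARD('n))\<^sup>2 - (tls_sv A b)\<^sup>2"
  have \<delta>: "\<delta> > 0" unfolding \<delta>_def using gen by (rule tls_generic_pos)
  have "((\<lambda>y. norm (data_rhs y v* data_mat y) / ((singular_value (data_mat y) CARD('n))\<^sup>2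
      - (tls_sv (data_mat y) (data_rhs y))\<^sup>2)) \<longlongrightarrow> norm (b v* A) / \<delta>) (at y0)"
    unfolding \<delta>_def
    by (intro tendsto_intros lims sv svA bounded_bilinear.tendsto[OF bounded_bilinear_vector_matrix_mult])
      (use \<delta> \<delta>_def in simp)
  from order_tendstoD(2)[OF this less_add_one]
  have "\<forall>\<^sub>F y in at y0. norm (data_rhs y v* data_mat y) / ((singular_value (data_mat y) CARD('n))\<^sup>2
      - (tls_sv (data_mat y) (data_rhs y))\<^sup>2) < norm (b v* A) / \<delta> + 1" .
  then obtain K where K: "\<forall>\<^sub>F y in at y0. norm (tls_map y) \<le> K"
  proof (rule that[OF eventually_elim2[OF _ ev]])
    fix y :: "real^(('n \<times> 'm) + 'm)"
    assume "tls_generic (data_mat y) (data_rhs y)"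
      "norm (data_rhs y v* data_mat y) / ((singular_value (data_mat y) CARD('n))\<^sup>2
      - (tls_sv (data_mat y) (data_rhs y))\<^sup>2) < norm (b v* A) / \<delta> + 1"
    then show "norm (tls_map y) \<le> norm (b v* A) / \<delta> + 1"
      using norm_tls_formula_le[of "data_mat y" "data_rhs y"] unfolding tls_map_def by linarith
  qed
  \<comment> \<open>The triangle-inequality bound for that right-hand side, with
    \<open>norm g\<close> replaced by \<open>K\<close>, divided by \<open>\<delta>\<close>.\<close>
  define U where "U y = ((norm (data_rhs y - b) + norm (data_mat y - A) * K) * norm A
     + (norm (data_rhs y) + norm (data_mat y) * K) * norm (data_mat y - A)
     + \<bar>(tls_sv (data_mat y) (data_rhs y))\<^sup>2 - (tls_sv A b)\<^sup>2\<bar> * K) / \<delta>" for y :: "real^(('n \<times> 'm) + 'm)"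
  have "(U \<longlongrightarrow> ((norm (b - b) + norm (A - A) * K) * norm A
     + (norm b + norm A * K) * norm (A - A)
     + \<bar>(tls_sv A b)\<^sup>2 - (tls_sv A b)\<^sup>2\<bar> * K) / \<delta>) (at y0)"
    unfolding U_def by (intro tendsto_intros lims sv) (use \<delta> in simp)
  then have U: "(U \<longlongrightarrow> 0) (at y0)" by simp
  have "((\<lambda>y. tls_map y - tls_map y0) \<longlongrightarrow> 0) (at y0)"
  proof (rule Lim_null_comparison[OF _ U])
    show "\<forall>\<^sub>F y in at y0. norm (tls_map y - tls_map y0) \<le> U y"
      using ev K
    proof eventually_elim
      case (elim y)
      define g where "g = tls_formula (data_mat y) (data_rhs y)"
      define x where "x = tls_formula A b"
      have K: "norm g \<le> K" "0 \<le> K"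
        using elim(2) norm_ge_zero[of "tls_map y"] unfolding tls_map_def g_def by linarith+
      let ?A = "data_mat y" and ?b = "data_rhs y"
      let ?R = "(?b - b - (?A - A) *v g) v* A + (?b - ?A *v g) v* (?A - A)
        + ((tls_sv ?A ?b)\<^sup>2 - (tls_sv A b)\<^sup>2) *\<^sub>R g"
      have m: "norm (X *v g) \<le> norm X * K" for X :: "real^'n^'m"
        by (rule order_trans[OF norm_matrix_vector_mult_le]) (simp add: K mult_left_mono)
      have "norm ?R \<le> norm (?b - b - (?A - A) *v g) * norm A + norm (?b - ?A *v g) * norm (?A - A)
          + \<bar>(tls_sv ?A ?b)\<^sup>2 - (tls_sv A b)\<^sup>2\<bar> * norm g"
        by (intro norm_triangle_le add_mono norm_vector_matrix_mult_le) simp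
      also have "\<dots> \<le> (norm (?b - b) + norm (?A - A) * K) * norm A
          + (norm ?b + norm ?A * K) * norm (?A - A) + \<bar>(tls_sv ?A ?b)\<^sup>2 - (tls_sv A b)\<^sup>2\<bar> * K"
      proof (intro add_mono mult_right_mono mult_left_mono K)
        show "norm (?b - b - (?A - A) *v g) \<le> norm (?b - b) + norm (?A - A) * K"
          by (rule order_trans[OF norm_triangle_ineq4]) (simp add: m)
        show "norm (?b - ?A *v g) \<le> norm ?b + norm ?A * K"
          by (rule order_trans[OF norm_triangle_ineq4]) (simp add: m)
      qed auto
      finally have R: "norm ?R \<le> U y * \<delta>" using \<delta> by (simp add: U_def)
      have "\<delta> * (norm (g - x))\<^sup>2 \<le> ?R \<bullet> (g - x)"
        unfolding tls_perturbation(1)[OF gen elim(1), folded g_def x_def, symmetric] \<delta>_def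
        by (rule tls_coercive)
      also have "\<dots> \<le> norm ?R * norm (g - x)" by (rule norm_cauchy_schwarz)
      also have "\<dots> \<le> U y * \<delta> * norm (g - x)" using R by (rule mult_right_mono) simp
      finally have "(norm (g - x) * \<delta>) * norm (g - x) \<le> (U y * \<delta>) * norm (g - x)"
        by (simp add: power2_eq_square mult.commute mult.left_commute)
      moreover have "0 \<le> U y" using K \<delta> by (simp add: U_def)
      ultimately have "norm (g - x) \<le> U y"
        using \<delta> by (cases "norm (g - x) = 0") (auto simp: mult_le_cancel_right)
      then show ?case by (simp add: tls_map_def y0 g_def x_def)
    qed
  qed
  then show ?thesis unfolding isCont_def y0_def[symmetric] by (rule LIM_zero_cancel)
qed

text \<open>The first-order part of the perturbation identities: \<open>s\<close> is the change of
  the residual with \<open>x\<close> held fixed, and the coefficient of \<open>x\<close> is the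
  first-order change of \<open>\<lambda>\<close>.\<close>

definition tls_deriv :: "real^'n^'m \<Rightarrow> real^'m \<Rightarrow> real^(('n::finite \<times> 'm::finite) + 'm) \<Rightarrow> real^'n" where
  "tls_deriv A b d =
    (let x = tls_formula A b; r = b - A *v x; s = data_rhs d - data_mat d *v x
     in matrix_inv (transpose A ** A - (tls_sv A b)\<^sup>2 *\<^sub>R mat 1) *v
       (s v* A + r v* data_mat d + (2 * (r \<bullet> s) / (1 + (norm x)\<^sup>2)) *\<^sub>R x))"

text \<open>Near the data \<open>tls_map y = x + matrix_inv P *v T y\<close>, where in every term of
  \<open>T\<close> a factor that vanishes at the data multiplies a continuous one.\<close>

lemma tls_map_has_derivative:
  fixes A :: "real^'n^'m"
  assumes gen: "tls_generic A b"
  shows "(tls_map has_derivative tls_deriv A b) (at (data_vec A b))"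
proof -
  define y0 where "y0 = data_vec A b"
  have y0: "data_mat y0 = A" "data_rhs y0 = b" by (simp_all add: y0_def)
  define x where "x = tls_formula A b"
  have x: "tls_map y0 = x" by (simp add: tls_map_def y0 x_def)
  note ev = eventually_tls_generic[OF gen, folded y0_def]
  note g = isCont_tls_map[OF gen, folded y0_def]
  define r where "r = b - A *v x"
  define r1 where "r1 y = data_rhs y - data_mat y *v tls_map y" for y :: "real^(('n \<times> 'm) + 'm)"
  have r1: "isCont r1 y0" unfolding r1_def
    by (intro continuous_intros isCont_data_rhs bounded_bilinear.isCont[OF bounded_bilinear_matrix_vector_mult]
        isCont_data_mat g)
  have r1y0: "r1 y0 = r" by (simp add: r1_def r_def y0 x)
  define s where "s y = data_rhs y - b - (data_mat y - A) *v tls_map y" for y :: "real^(('n \<times> 'm) + 'm)"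
  define s' where "s' d = data_rhs d - data_mat d *v x" for d :: "real^(('n \<times> 'm) + 'm)"
  have dA: "((\<lambda>y. data_mat y - A) has_derivative data_mat) (at y0)"
    using has_derivative_diff[OF bounded_linear_imp_has_derivative[OF bounded_linear_data_mat] has_derivative_const]
    by simp
  have db: "((\<lambda>y. data_rhs y - b) has_derivative data_rhs) (at y0)"
    using has_derivative_diff[OF bounded_linear_imp_has_derivative[OF bounded_linear_data_rhs] has_derivative_const]
    by simp
  have s: "(s has_derivative s') (at y0)"
    unfolding s_def s'_def x[symmetric]
    by (intro has_derivative_diff db
        has_derivative_vanishing_factor[OF bounded_bilinear_matrix_vector_mult dA _ g]) (simp add: y0)
  \<comment> \<open>\<open>s\<close> contains the moving solution, this map the fixed
    \<open>x\<close>. Both have derivative \<open>s'\<close>, since the matrix difference vanishes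
    at \<open>y0\<close>.\<close>
  have d: "((\<lambda>y. data_rhs y - b - (data_mat y - A) *v x) has_derivative s') (at y0)"
    unfolding s'_def
    by (intro has_derivative_diff db
        has_derivative_vanishing_factor[OF bounded_bilinear_matrix_vector_mult dA]) (simp_all add: y0)
  have s0: "s y0 = 0" by (simp add: s_def y0)
  \<comment> \<open>The right side of the eigenvalue identity; the quotient \<open>\<mu>\<close>
    below is the change of \<open>\<lambda>\<close> near the data.\<close>
  define \<nu> where "\<nu> y = (data_rhs y - b - (data_mat y - A) *v x) \<bullet> r1 y + r \<bullet> s y" for y :: "real^(('n \<times> 'm) + 'm)"
  have \<nu>: "(\<nu> has_derivative (\<lambda>d. s' d \<bullet> r + r \<bullet> s' d)) (at y0)"
    unfolding \<nu>_def
    using has_derivative_add[OF has_derivative_vanishing_factor[OF bounded_bilinear_inner d _ r1]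
        bounded_linear.has_derivative[OF bounded_linear_inner_right s, of r]]
    by (simp add: y0 r1y0)
  have \<nu>0: "\<nu> y0 = 0" by (simp add: \<nu>_def y0 s0)
  have nz: "1 + x \<bullet> x \<noteq> 0" by (smt (verit) inner_ge_zero)
  have h: "isCont (\<lambda>y. inverse (1 + tls_map y \<bullet> x)) y0"
    by (intro continuous_intros g) (simp add: x nz)
  define \<mu> where "\<mu> y = \<nu> y * inverse (1 + tls_map y \<bullet> x)" for y :: "real^(('n \<times> 'm) + 'm)"
  have \<mu>: "(\<mu> has_derivative (\<lambda>d. (s' d \<bullet> r + r \<bullet> s' d) * inverse (1 + x \<bullet> x))) (at y0)"
    using has_derivative_vanishing_factor[OF bounded_bilinear_mult \<nu> \<nu>0 h] unfolding \<mu>_def x .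
  have \<mu>0: "\<mu> y0 = 0" by (simp add: \<mu>_def \<nu>0)
  define T where "T y = s y v* A + r1 y v* (data_mat y - A) + \<mu> y *\<^sub>R tls_map y" for y :: "real^(('n \<times> 'm) + 'm)"
  have T: "(T has_derivative (\<lambda>d. s' d v* A + r v* data_mat d
      + ((s' d \<bullet> r + r \<bullet> s' d) * inverse (1 + x \<bullet> x)) *\<^sub>R x)) (at y0)"
    unfolding T_def
  proof (intro has_derivative_add)
    show "((\<lambda>y. s y v* A) has_derivative (\<lambda>d. s' d v* A)) (at y0)"
      by (rule bounded_linear.has_derivative[OF
            bounded_bilinear.bounded_linear_left[OF bounded_bilinear_vector_matrix_mult] s])
    show "((\<lambda>y. r1 y v* (data_mat y - A)) has_derivative (\<lambda>d. r v* data_mat d)) (at y0)"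
      using has_derivative_vanishing_factor[OF
          bounded_bilinear.flip[OF bounded_bilinear_vector_matrix_mult] dA _ r1]
      by (simp add: y0 r1y0)
    show "((\<lambda>y. \<mu> y *\<^sub>R tls_map y) has_derivative
        (\<lambda>d. ((s' d \<bullet> r + r \<bullet> s' d) * inverse (1 + x \<bullet> x)) *\<^sub>R x)) (at y0)"
      using has_derivative_vanishing_factor[OF bounded_bilinear_scaleR \<mu> \<mu>0 g] unfolding x .
  qed
  define P where "P = transpose A ** A - (tls_sv A b)\<^sup>2 *\<^sub>R mat 1"
  have "((\<lambda>y. matrix_inv P *v T y) has_derivative (\<lambda>d. matrix_inv P *v (s' d v* A + r v* data_mat d
      + ((s' d \<bullet> r + r \<bullet> s' d) * inverse (1 + x \<bullet> x)) *\<^sub>R x))) (at y0)"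
    by (rule bounded_linear.has_derivative[OF matrix_vector_mul_bounded_linear T])
  also have "(\<lambda>d. matrix_inv P *v (s' d v* A + r v* data_mat d
      + ((s' d \<bullet> r + r \<bullet> s' d) * inverse (1 + x \<bullet> x)) *\<^sub>R x)) = tls_deriv A b"
    by (rule ext) (simp add: tls_deriv_def Let_def P_def s'_def r_def x_def inner_commute
        power2_norm_eq_inner divide_inverse)
  finally have "((\<lambda>y. x + matrix_inv P *v T y) has_derivative tls_deriv A b) (at y0)"
    using has_derivative_add[OF has_derivative_const[of x]] by fastforce
  then show ?thesis
    unfolding y0_def[symmetric]
  proof (rule has_derivative_transform_eventually)
    have "((\<lambda>y. 1 + tls_map y \<bullet> x) \<longlongrightarrow> 1 + x \<bullet> x) (at y0)"
      using g unfolding isCont_def x by (intro tendsto_intros)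
    then have "\<forall>\<^sub>F y in at y0. 1 + tls_map y \<bullet> x \<noteq> 0"
      using nz by (rule tendsto_imp_eventually_ne)
    with ev show "\<forall>\<^sub>F y in at y0. x + matrix_inv P *v T y = tls_map y"
    proof eventually_elim
      case (elim y)
      note p = tls_perturbation[OF gen elim(1), folded x_def tls_map_def]
      have "\<mu> y = (tls_sv (data_mat y) (data_rhs y))\<^sup>2 - (tls_sv A b)\<^sup>2"
        using p(2) elim(2) unfolding \<mu>_def \<nu>_def s_def r_def r1_def by (simp add: field_simps inner_commute)
      then have "T y = P *v (tls_map y - x)"
        unfolding T_def P_def gram_shift_mult p(1) s_def r1_def by simp
      then show ?case
        using tls_matrix_inv(1)[OF gen, folded P_def] by simp
    qed
    show "x + matrix_inv P *v T y0 = tls_map y0"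
      by (simp add: T_def s0 y0 \<mu>0 x)
  qed simp
qed

subsection \<open>The norm of the derivative\<close>

text \<open>\<open>K\<^sup>T P u\<close> rather than \<open>K\<^sup>T u\<close>, where \<open>K\<close> is the derivative: this avoids the inverse of \<open>P\<close>.\<close>

definition tls_adjoint :: "real^'n^'m \<Rightarrow> real^'m \<Rightarrow> real^'n \<Rightarrow> real^(('n::finite \<times> 'm::finite) + 'm)" where
  "tls_adjoint A b u =
    (let x = tls_formula A b; r = b - A *v x; t = A *v u + (2 * (x \<bullet> u) / (1 + (norm x)\<^sup>2)) *\<^sub>R r
     in data_vec (outer r u - outer t x) t)"

text \<open>\<open>P\<close> is symmetric and cancels its inverse, leaving
  \<open>q \<bullet> u\<close>. Collecting the terms in \<open>s\<close> and
  \<open>data_mat d\<close> exhibits this as an inner product with \<open>d\<close>.\<close>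

lemma inner_tls_deriv:
  fixes A :: "real^'n^'m"
  assumes gen: "tls_generic A b"
  shows "tls_deriv A b d \<bullet> ((A *v u) v* A - (tls_sv A b)\<^sup>2 *\<^sub>R u) = d \<bullet> tls_adjoint A b u"
proof -
  define x where "x = tls_formula A b"
  define r where "r = b - A *v x"
  define s where "s = data_rhs d - data_mat d *v x"
  define \<rho> where "\<rho> = 1 + (norm x)\<^sup>2"
  define t where "t = A *v u + (2 * (x \<bullet> u) / \<rho>) *\<^sub>R r"
  define q where "q = s v* A + r v* data_mat d + (2 * (r \<bullet> s) / \<rho>) *\<^sub>R x"
  define P where "P = transpose A ** A - (tls_sv A b)\<^sup>2 *\<^sub>R mat 1"
  have sym: "v \<bullet> (P *v w) = (P *v v) \<bullet> w" for v w
    unfolding P_def gram_shift_mult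
    by (simp add: inner_diff_left inner_diff_right dot_lmul_matrix
        inner_commute[of v "_ v* A"] inner_commute[of "A *v w"])
  have "tls_deriv A b d = matrix_inv P *v q"
    by (simp add: tls_deriv_def Let_def P_def q_def s_def r_def x_def \<rho>_def)
  then have "tls_deriv A b d \<bullet> (P *v u) = q \<bullet> u"
    unfolding sym using tls_matrix_inv(2)[OF gen, folded P_def] by simp
  also have "\<dots> = s \<bullet> t + r \<bullet> (data_mat d *v u)"
    unfolding q_def t_def
    by (simp add: inner_add_left inner_add_right dot_lmul_matrix inner_commute[of s r])
  also have "\<dots> = d \<bullet> data_vec (outer r u - outer t x) t"
    unfolding inner_data_vec s_def
    by (simp add: inner_diff_left inner_diff_right inner_outer inner_commute[of r])
  finally show ?thesis
    unfolding P_def gram_shift_mult tls_adjoint_def Let_def t_def r_def x_def \<rho>_def .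
qed

text \<open>Since \<open>r \<bullet> r = l * \<rho>\<close> and
  \<open>r \<bullet> (A *v u) = - (l * (x \<bullet> u))\<close>, the vector \<open>t\<close> is the
  reflection of \<open>A *v u\<close> in the hyperplane orthogonal to \<open>r\<close> (and equals
  \<open>A *v u\<close> if \<open>r = 0\<close>). So \<open>t\<close> keeps the norm and
  \<open>r \<bullet> t\<close> changes sign.\<close>

lemma norm_tls_adjoint:
  fixes A :: "real^'n^'m"
  assumes gen: "tls_generic A b"
  defines "x \<equiv> tls_formula A b"
  shows "(norm (tls_adjoint A b u))\<^sup>2
    = (1 + (norm x)\<^sup>2) * ((norm (A *v u))\<^sup>2 + (tls_sv A b)\<^sup>2 * (norm u)\<^sup>2)
      - 2 * (tls_sv A b)\<^sup>2 * (x \<bullet> u)\<^sup>2"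
proof -
  define r where "r = b - A *v x"
  define \<rho> where "\<rho> = 1 + (norm x)\<^sup>2"
  have \<rho>: "\<rho> > 0" unfolding \<rho>_def by (simp add: add_pos_nonneg)
  define c where "c = 2 * (x \<bullet> u) / \<rho>"
  have c: "c * \<rho> = 2 * (x \<bullet> u)" using \<rho> by (simp add: c_def)
  define t where "t = A *v u + c *\<^sub>R r"
  define l where "l = (tls_sv A b)\<^sup>2"
  have rr: "r \<bullet> r = l * \<rho>"
    using tls_residual_inner[OF gen, of x, folded x_def]
    by (simp add: r_def l_def \<rho>_def power2_norm_eq_inner inner_diff_left inner_diff_right)
  have "r v* A = - ((A *v x - b) v* A)"
    unfolding r_def vector_matrix_mult_diff_distrib by simp
  then have "r v* A = - (l *\<^sub>R x)"
    using tls_formula_eigenvector(1)[OF gen] by (simp add: x_def l_def)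
  then have rA: "r \<bullet> (A *v u) = - (l * (x \<bullet> u))"
    by (simp flip: dot_lmul_matrix)
  have lc: "c * (l * \<rho>) = 2 * (l * (x \<bullet> u))"
    using arg_cong[OF c, of "(*) l"] by (simp only: mult.left_commute mult.commute)
  have rt: "r \<bullet> t = l * (x \<bullet> u)"
    unfolding t_def inner_add_right inner_scaleR_right rA rr lc by simp
  have "t \<bullet> t = (A *v u) \<bullet> (A *v u) + 2 * c * (r \<bullet> (A *v u)) + c * (c * (r \<bullet> r))"
    by (simp add: t_def inner_add_left inner_add_right inner_commute[of "A *v u" r] distrib_left)
  also have "\<dots> = (A *v u) \<bullet> (A *v u)"
    unfolding rA rr lc by simp
  finally have tt: "t \<bullet> t = (norm (A *v u))\<^sup>2" by (simp add: power2_norm_eq_inner)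
  have "(norm (tls_adjoint A b u))\<^sup>2 = (norm (outer r u - outer t x))\<^sup>2 + (norm t)\<^sup>2"
    unfolding tls_adjoint_def Let_def x_def[symmetric] r_def[symmetric] \<rho>_def[symmetric]
      c_def[symmetric] t_def[symmetric] by (rule norm_data_vec)
  also have "(norm (outer r u - outer t x))\<^sup>2
      = (norm (outer r u))\<^sup>2 - 2 * (outer r u \<bullet> outer t x) + (norm (outer t x))\<^sup>2"
    by (simp add: power2_norm_eq_inner inner_diff_left inner_diff_right inner_commute)
  also have "\<dots> = l * \<rho> * (norm u)\<^sup>2 - 2 * l * (x \<bullet> u)\<^sup>2 + (norm (A *v u))\<^sup>2 * (norm x)\<^sup>2"
    unfolding inner_outer outer_mult norm_outer power_mult_distrib
    unfolding power2_norm_eq_inner[of r] power2_norm_eq_inner[of t] rr tt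
    by (simp add: rt inner_commute[of u x] power2_eq_square[of "x \<bullet> u"] mult.left_commute)
  also have "(norm t)\<^sup>2 = (norm (A *v u))\<^sup>2" unfolding power2_norm_eq_inner[of t] by (rule tt)
  finally show ?thesis
    by (simp add: \<rho>_def l_def algebra_simps)
qed

text \<open>The matrix inequality \<open>(h - l)\<^sup>2 (H + l I) \<le> (h + l) (H - l I)\<^sup>2\<close> for \<open>H = A\<^sup>T A\<close> with spectrum above
  \<open>h\<close>, proved without diagonalising \<open>H\<close>.\<close>

lemma gram_shift_norm_ge:
  fixes A :: "real^'n^'m"
  assumes h: "h * (norm u)\<^sup>2 \<le> (norm (A *v u))\<^sup>2" and l: "0 \<le> l" "l < h"
  shows "(h - l)\<^sup>2 * ((norm (A *v u))\<^sup>2 + l * (norm u)\<^sup>2)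
    \<le> (h + l) * (norm ((A *v u) v* A - l *\<^sub>R u))\<^sup>2"
proof -
  \<comment> \<open>Split \<open>H - l I\<close> as \<open>(H - h I) + (h - l) I\<close>. In the
    expanded square all terms are nonnegative and the \<open>norm u\<close> terms of both sides
    agree; what remains is \<open>h - l \<le> 2 * (h + l)\<close>.\<close>
  define p where "p = (A *v u) v* A - h *\<^sub>R u"
  define q where "q = p \<bullet> u"
  have q: "q = (norm (A *v u))\<^sup>2 - h * (norm u)\<^sup>2"
    by (simp add: q_def p_def inner_diff_left dot_lmul_matrix power2_norm_eq_inner)
  have "q \<ge> 0" using h q by simp
  have "(A *v u) v* A - l *\<^sub>R u = p + (h - l) *\<^sub>R u" by (simp add: p_def algebra_simps)
  then have *: "(norm ((A *v u) v* A - l *\<^sub>R u))\<^sup>2 = p \<bullet> p + 2 * (h - l) * q + (h - l)\<^sup>2 * (norm u)\<^sup>2"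
    unfolding power2_norm_eq_inner power2_eq_square[of "h - l"]
    by (simp add: inner_add_left inner_add_right q_def inner_commute[of u p] distrib_left)
  have "(h - l)\<^sup>2 * q \<le> (h + l) * (2 * (h - l) * q)"
  proof -
    have "(h - l) * ((h - l) * q) \<le> (2 * (h + l)) * ((h - l) * q)"
      using l \<open>q \<ge> 0\<close> by (intro mult_right_mono mult_nonneg_nonneg) auto
    then show ?thesis by (simp only: power2_eq_square ac_simps)
  qed
  moreover have "0 \<le> (h + l) * (p \<bullet> p)" using l by simp
  moreover have "(norm (A *v u))\<^sup>2 = q + h * (norm u)\<^sup>2" using q by simp
  ultimately show ?thesis unfolding * by (simp add: algebra_simps)
qed

section \<open>The upper and the lower bound for the derivative\<close>

lemma sqrt_bound_power2:
  fixes \<rho> h l :: real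
  assumes "0 \<le> \<rho>" "0 \<le> h + l"
  shows "(sqrt \<rho> * sqrt (h + l) / (h - l))\<^sup>2 = \<rho> * ((h + l) / (h - l)\<^sup>2)"
  using assms by (simp add: power_mult_distrib power_divide)

text \<open>With \<open>k = K d\<close> and \<open>u\<close> the solution of \<open>P u = k\<close>,
  \<open>k \<bullet> k\<close> is the inner product of \<open>d\<close> with the adjoint at
  \<open>u\<close>, whose norm is at most \<open>\<kappa> * norm k\<close>. Cauchy-Schwarz and
  cancelling \<open>norm k\<close> finish.\<close>

lemma norm_tls_deriv_le:
  fixes A :: "real^'n^'m"
  assumes gen: "tls_generic A b"
  defines "h \<equiv> (singular_value A CARD('n))\<^sup>2" and "l \<equiv> (tls_sv A b)\<^sup>2"
  shows "norm (tls_deriv A b d)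
    \<le> sqrt (1 + (norm (tls_formula A b))\<^sup>2) * sqrt (h + l) / (h - l) * norm d"
proof -
  define k where "k = tls_deriv A b d"
  define \<rho> where "\<rho> = 1 + (norm (tls_formula A b))\<^sup>2"
  have \<rho>: "\<rho> > 0" unfolding \<rho>_def by (simp add: add_pos_nonneg)
  have hl: "h - l > 0" "l \<ge> 0" using tls_generic_pos[OF gen] by (simp_all add: h_def l_def)
  define \<kappa> where "\<kappa> = sqrt \<rho> * sqrt (h + l) / (h - l)"
  have "\<kappa> \<ge> 0" unfolding \<kappa>_def using hl \<rho> by auto
  define u where "u = matrix_inv (transpose A ** A - l *\<^sub>R mat 1) *v k"
  have u: "(A *v u) v* A - l *\<^sub>R u = k"
    using tls_matrix_inv(2)[OF gen, of k] unfolding u_def l_def gram_shift_mult .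
  have "(norm (tls_adjoint A b u))\<^sup>2 \<le> \<rho> * ((norm (A *v u))\<^sup>2 + l * (norm u)\<^sup>2)"
  proof -
    have "0 \<le> 2 * l * (tls_formula A b \<bullet> u)\<^sup>2" using hl(2) by simp
    then show ?thesis unfolding norm_tls_adjoint[OF gen] \<rho>_def[symmetric] l_def[symmetric] by linarith
  qed
  also have "\<dots> \<le> \<rho> * ((h + l) / (h - l)\<^sup>2 * (norm k)\<^sup>2)"
  proof (rule mult_left_mono)
    have "(h - l)\<^sup>2 * ((norm (A *v u))\<^sup>2 + l * (norm u)\<^sup>2) \<le> (h + l) * (norm k)\<^sup>2"
      unfolding u[symmetric] using hl last_singular_value(3)[of A u]
      by (intro gram_shift_norm_ge) (auto simp: h_def)
    then show "(norm (A *v u))\<^sup>2 + l * (norm u)\<^sup>2 \<le> (h + l) / (h - l)\<^sup>2 * (norm k)\<^sup>2"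
      using hl by (simp add: pos_le_divide_eq mult.commute)
  qed (use \<rho> in simp)
  also have "\<dots> = (\<kappa> * norm k)\<^sup>2"
    unfolding \<kappa>_def power_mult_distrib[of _ "norm k"] using \<rho> hl by (subst sqrt_bound_power2) auto
  finally have adj: "norm (tls_adjoint A b u) \<le> \<kappa> * norm k"
    by (rule power2_le_imp_le) (use \<open>\<kappa> \<ge> 0\<close> in simp)
  have "norm k * norm k = k \<bullet> k" by (metis power2_eq_square power2_norm_eq_inner)
  also have "\<dots> = d \<bullet> tls_adjoint A b u"
    using inner_tls_deriv[OF gen, of d u] unfolding l_def[symmetric] u k_def[symmetric] .
  also have "\<dots> \<le> norm d * norm (tls_adjoint A b u)" by (rule norm_cauchy_schwarz)
  also have "\<dots> \<le> norm d * (\<kappa> * norm k)" using adj by (rule mult_left_mono) simp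
  finally have *: "norm k * norm k \<le> (\<kappa> * norm d) * norm k" by (simp only: ac_simps)
  have "norm k \<le> \<kappa> * norm d"
  proof (cases "k = 0")
    case True
    then show ?thesis using \<open>\<kappa> \<ge> 0\<close> by simp
  next
    case False
    then show ?thesis using mult_right_le_imp_le[OF *] by simp
  qed
  then show ?thesis by (simp add: k_def \<kappa>_def \<rho>_def)
qed

text \<open>The derivative is evaluated at the adjoint value \<open>a\<close> itself:
  \<open>a \<bullet> a = K a \<bullet> k\<close> with \<open>k = P u\<close> gives
  \<open>norm a \<le> onorm K * norm k\<close>, while the choice of \<open>u\<close> makes
  \<open>norm a\<close> at least \<open>\<kappa> * norm k\<close>.\<close>

lemma onorm_tls_deriv_ge:
  fixes A :: "real^'n^'m"
  assumes gen: "tls_generic A b" and n: "CARD('n) \<ge> 2"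
  defines "h \<equiv> (singular_value A (CARD('n) - 1))\<^sup>2" and "l \<equiv> (tls_sv A b)\<^sup>2"
  shows "sqrt (1 + (norm (tls_formula A b))\<^sup>2) * sqrt (h + l) / (h - l) \<le> onorm (tls_deriv A b)"
proof -
  define x where "x = tls_formula A b"
  define \<rho> where "\<rho> = 1 + (norm x)\<^sup>2"
  have \<rho>: "\<rho> > 0" unfolding \<rho>_def by (simp add: add_pos_nonneg)
  define h2 where "h2 = (singular_value A CARD('n))\<^sup>2"
  obtain v w where vw: "v \<noteq> 0" "w \<noteq> 0" "v \<bullet> w = 0" "(A *v v) v* A = h *\<^sub>R v" "(A *v w) v* A = h2 *\<^sub>R w"
    "singular_value A CARD('n) \<le> singular_value A (CARD('n) - 1)"
    using last_two_singular_vectors[OF n, of A] unfolding h_def h2_def transpose_mult_vector by metis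
  have h: "h2 \<le> h" unfolding h_def h2_def
    using vw(6) last_singular_value(1)[of A] by (rule power_mono)
  have l: "l \<ge> 0" "l < h2" using tls_generic_pos[OF gen] by (simp_all add: l_def h2_def)
  \<comment> \<open>One linear equation in two unknowns has a nontrivial solution; the resulting
    \<open>u\<close> is orthogonal to \<open>x\<close>, so the negative term of
    \<open>norm_tls_adjoint\<close> vanishes.\<close>
  obtain \<alpha> \<beta> where ab: "\<alpha> \<noteq> 0 \<or> \<beta> \<noteq> 0" "\<alpha> * (x \<bullet> v) + \<beta> * (x \<bullet> w) = 0"
  proof (cases "x \<bullet> v = 0")
    case True
    then show ?thesis using that[of 1 0] by simp
  next
    case False
    then show ?thesis using that[of "- (x \<bullet> w)" "x \<bullet> v"] by simp
  qed
  define u where "u = \<alpha> *\<^sub>R v + \<beta> *\<^sub>R w"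
  define k where "k = (A *v u) v* A - l *\<^sub>R u"
  have wv: "w \<bullet> v = 0" using vw(3) by (simp add: inner_commute)
  have Hu: "(A *v u) v* A = (\<alpha> * h) *\<^sub>R v + (\<beta> * h2) *\<^sub>R w"
    by (simp add: u_def matrix_vector_right_distrib matrix_vector_mult_scaleR
        vector_matrix_left_distrib scaleR_vector_matrix_assoc vw)
  have k: "k = (\<alpha> * (h - l)) *\<^sub>R v + (\<beta> * (h2 - l)) *\<^sub>R w"
    unfolding k_def Hu by (simp add: u_def algebra_simps)
  have kk: "(norm k)\<^sup>2 = \<alpha>\<^sup>2 * (norm v)\<^sup>2 * (h - l)\<^sup>2 + \<beta>\<^sup>2 * (norm w)\<^sup>2 * (h2 - l)\<^sup>2"
    unfolding k power2_norm_eq_inner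
    by (simp add: inner_add_left inner_add_right vw(3) wv power2_eq_square)
  have uu: "(norm u)\<^sup>2 = \<alpha>\<^sup>2 * (norm v)\<^sup>2 + \<beta>\<^sup>2 * (norm w)\<^sup>2"
    unfolding u_def power2_norm_eq_inner
    by (simp add: inner_add_left inner_add_right vw(3) wv power2_eq_square)
  have "(norm (A *v u))\<^sup>2 = ((A *v u) v* A) \<bullet> u"
    by (simp add: dot_lmul_matrix power2_norm_eq_inner)
  also have "\<dots> = \<alpha>\<^sup>2 * (norm v)\<^sup>2 * h + \<beta>\<^sup>2 * (norm w)\<^sup>2 * h2"
    unfolding Hu unfolding u_def power2_norm_eq_inner
    by (simp add: inner_add_left inner_add_right vw(3) wv power2_eq_square)
  finally have Au: "(norm (A *v u))\<^sup>2 = \<dots>" .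
  have "k \<noteq> 0"
  proof
    assume "k = 0"
    then have "\<alpha>\<^sup>2 * (norm v)\<^sup>2 * (h - l)\<^sup>2 = 0" "\<beta>\<^sup>2 * (norm w)\<^sup>2 * (h2 - l)\<^sup>2 = 0"
      using kk by (simp_all add: add_nonneg_eq_0_iff)
    then show False using ab(1) vw(1,2) h l by auto
  qed
  have "(h + l) * (norm k)\<^sup>2 \<le> (h - l)\<^sup>2 * ((norm (A *v u))\<^sup>2 + l * (norm u)\<^sup>2)"
  proof -
    \<comment> \<open>The function \<open>(s + l) / (s - l)^2\<close> is decreasing for
      \<open>s > l\<close>. Only the \<open>w\<close> component needs this; the \<open>v\<close>
      component gives equality.\<close>
    have "(h + l) * (h2 - l)\<^sup>2 \<le> (h - l)\<^sup>2 * (h2 + l)"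
    proof -
      have "(h - l) * (h2 - l) * (h2 - l) \<le> (h - l) * (h2 - l) * (h - l)"
        using h l by (intro mult_left_mono) auto
      moreover have "2 * l * (h2 - l)\<^sup>2 \<le> 2 * l * (h - l)\<^sup>2"
        using h l by (intro mult_left_mono power_mono) auto
      ultimately show ?thesis by (simp add: power2_eq_square algebra_simps)
    qed
    then have "\<beta>\<^sup>2 * (norm w)\<^sup>2 * ((h + l) * (h2 - l)\<^sup>2) \<le> \<beta>\<^sup>2 * (norm w)\<^sup>2 * ((h - l)\<^sup>2 * (h2 + l))"
      by (rule mult_left_mono) simp
    then show ?thesis unfolding kk Au uu by (simp add: algebra_simps)
  qed
  then have "\<rho> * ((h + l) / (h - l)\<^sup>2) * (norm k)\<^sup>2 \<le> \<rho> * ((norm (A *v u))\<^sup>2 + l * (norm u)\<^sup>2)"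
    unfolding mult.assoc using \<rho> h l by (intro mult_left_mono) (auto simp: pos_divide_le_eq mult.commute)
  also have "\<dots> = (norm (tls_adjoint A b u))\<^sup>2"
    unfolding norm_tls_adjoint[OF gen] x_def[symmetric] \<rho>_def l_def
    using ab(2) by (simp add: u_def inner_add_right)
  finally have le: "\<rho> * ((h + l) / (h - l)\<^sup>2) * (norm k)\<^sup>2 \<le> (norm (tls_adjoint A b u))\<^sup>2" .
  define \<kappa> where "\<kappa> = sqrt \<rho> * sqrt (h + l) / (h - l)"
  have "(\<kappa> * norm k)\<^sup>2 \<le> (norm (tls_adjoint A b u))\<^sup>2"
    unfolding \<kappa>_def power_mult_distrib[of _ "norm k"] using le \<rho> h l by (subst sqrt_bound_power2) auto
  then have adj: "\<kappa> * norm k \<le> norm (tls_adjoint A b u)" by (rule power2_le_imp_le) simp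
  define a where "a = tls_adjoint A b u"
  have "bounded_linear (tls_deriv A b)"
    using tls_map_has_derivative[OF gen] by (rule has_derivative_bounded_linear)
  then have on: "norm (tls_deriv A b a) \<le> onorm (tls_deriv A b) * norm a" by (rule onorm)
  have "norm a * norm a = a \<bullet> a" by (metis power2_eq_square power2_norm_eq_inner)
  also have "\<dots> = tls_deriv A b a \<bullet> k"
    unfolding a_def k_def l_def by (rule inner_tls_deriv[OF gen, symmetric])
  also have "\<dots> \<le> norm (tls_deriv A b a) * norm k" by (rule norm_cauchy_schwarz)
  also have "\<dots> \<le> onorm (tls_deriv A b) * norm a * norm k" using on by (rule mult_right_mono) simp
  finally have *: "norm a * norm a \<le> (onorm (tls_deriv A b) * norm k) * norm a" by (simp only: ac_simps)
  have "norm a > 0"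
  proof -
    have "0 < \<kappa> * norm k" unfolding \<kappa>_def using \<open>k \<noteq> 0\<close> \<rho> h l by simp
    then show ?thesis using adj unfolding a_def by linarith
  qed
  with * have "norm a \<le> onorm (tls_deriv A b) * norm k" by (rule mult_right_le_imp_le)
  then have "\<kappa> * norm k \<le> onorm (tls_deriv A b) * norm k" using adj a_def by simp
  then have "\<kappa> \<le> onorm (tls_deriv A b)" by (rule mult_right_le_imp_le) (use \<open>k \<noteq> 0\<close> in simp)
  then show ?thesis by (simp add: \<kappa>_def \<rho>_def x_def)
qed

theorem theorem8:
  fixes A :: "real^'n^'m" and b :: "real^'m" and x :: "real^'n"
    and \<sigma>A \<sigma>Ab :: "nat \<Rightarrow> real" and n :: nat
  defines "n \<equiv> CARD('n)"
    and "\<sigma>A \<equiv> singular_value A"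
    and "\<sigma>Ab \<equiv> singular_value (append_col A b)"
  assumes "CARD('m) > n" and "n \<ge> 2"
    and "0 < \<sigma>Ab (n + 1)" and "\<sigma>Ab (n + 1) < \<sigma>A n"
    and "tls_solution A b x"
  shows "tls_map differentiable (at (data_vec A b)) \<and>
    sqrt (1 + (norm x)\<^sup>2) * sqrt ((\<sigma>A (n - 1))\<^sup>2 + (\<sigma>Ab (n + 1))\<^sup>2)
        / ((\<sigma>A (n - 1))\<^sup>2 - (\<sigma>Ab (n + 1))\<^sup>2) \<le> tls_cond A b \<and>
    tls_cond A b \<le> sqrt (1 + (norm x)\<^sup>2) * sqrt ((\<sigma>A n)\<^sup>2 + (\<sigma>Ab (n + 1))\<^sup>2)
        / ((\<sigma>A n)\<^sup>2 - (\<sigma>Ab (n + 1))\<^sup>2)"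
proof -
  have \<sigma>: "\<sigma>Ab (n + 1) = tls_sv A b" by (simp add: \<sigma>Ab_def n_def tls_sv_def)
  have gen: "tls_generic A b" using assms(7) unfolding tls_generic_def \<sigma> by (simp add: \<sigma>A_def n_def)
  \<comment> \<open>Identifies the given minimiser with the value of \<open>tls_map\<close> at the
    data, so that the bounds can be stated with \<open>norm x\<close>.\<close>
  have x: "x = tls_formula A b" using tls_solution_eq_formula[OF gen assms(8)] .
  note D = tls_map_has_derivative[OF gen]
  have cond: "tls_cond A b = onorm (tls_deriv A b)"
    unfolding tls_cond_def frechet_derivative_at[OF D] ..
  show ?thesis
    unfolding \<sigma> cond x
  proof (intro conjI)
    show "tls_map differentiable (at (data_vec A b))" using D by (rule differentiableI)
    show "sqrt (1 + (norm (tls_formula A b))\<^sup>2) * sqrt ((\<sigma>A (n - 1))\<^sup>2 + (tls_sv A b)\<^sup>2)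
        / ((\<sigma>A (n - 1))\<^sup>2 - (tls_sv A b)\<^sup>2) \<le> onorm (tls_deriv A b)"
      unfolding \<sigma>A_def n_def using gen assms(5) n_def by (intro onorm_tls_deriv_ge) auto
    show "onorm (tls_deriv A b) \<le> sqrt (1 + (norm (tls_formula A b))\<^sup>2)
        * sqrt ((\<sigma>A n)\<^sup>2 + (tls_sv A b)\<^sup>2) / ((\<sigma>A n)\<^sup>2 - (tls_sv A b)\<^sup>2)"
      unfolding \<sigma>A_def n_def by (rule onorm_le) (rule norm_tls_deriv_le[OF gen])
  qed
qed

end
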